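(* Let $\mathcal{D}$ be a finite-dimensional real associative algebra whose center $Z(\mathcal{D})$ has dimension $1$ or $2$. Suppose that $\mathcal{D}$ can be endowed with a division grading with (nonzero) homogeneous components of dimension $1$ and whose support $T$ is a group isomorphic to $\mathbb{Z}_2^N$. For $t\in T$ choose $X_t\in\mathcal{D}_t$ with $X_t^2\in\{+1,-1\}$ and define $\mu(t)\in\{\pm1\}$ by $X_t^2=\mu(t)1$. Then $\mu:T\to\{\pm1\}$ is a quadratic form whose Arf invariant determines the real algebra $\mathcal{D}$ up to isomorphism, according to the following list. If $\dim Z(\mathcal{D})=1$ (which is equivalent to $N=2m$ being even), then: $\operatorname{Arf}(\mu)=+1$ implies $\mathcal{D}\cong M_{2^m}(\mathbb{R})$; $\operatorname{Arf}(\mu)=-1$ implies $\mathcal{D}\cong M_{2^{m-1}}(\mathbb{H})$. If $\dim Z(\mathcal{D})=2$ (which is equivalent to $N=2m+1$ being odd), then: $\operatorname{Arf}(\mu)=+1$ implies $\mathcal{D}\cong M_{2^m}(\mathbb{R})\times M_{2^m}(\mathbb{R})$; $\operatorname{Arf}(\mu)=0$ implies $\mathcal{D}\cong M_{2^m}(\mathbb{C})$; $\operatorname{Arf}(\mu)=-1$ implies $\mathcal{D}\cong M_{2^{m-1}}(\mathbb{H})\times M_{2^{m-1}}(\mathbb{H})$.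
   Context: A grading on an algebra $\mathcal{D}$ by a group $G$ is a vector space decomposition $\mathcal{D}=\bigoplus_{g\in G}\mathcal{D}_g$ with $\mathcal{D}_g\mathcal{D}_h\subseteq\mathcal{D}_{gh}$. The support is the set of $g$ with $\mathcal{D}_g\neq0$. A grading on a unital associative algebra is a division grading if every nonzero homogeneous element is invertible. An alternating bicharacter on $T$ is a map $\beta:T\times T\to\mathbb{R}\setminus\{0\}$ multiplicative in each variable with $\beta(u,u)=1$ for all $u\in T$. A quadratic form on $T$ is a map $\mu:T\to\{\pm1\}$ such that $\beta_\mu(u,v)=\mu(uv)\mu(u)^{-1}\mu(v)^{-1}$ is an alternating bicharacter. The Arf invariant of a map $\mu:T\to\{\pm1\}$ on a finite set $T$ is $\operatorname{Arf}(\mu)=\operatorname{sign}(|\mu^{-1}(+1)|-|\mu^{-1}(-1)|)\in\{+1,0,-1\}$, where $\operatorname{sign}(0)=0$. *)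

theory Defs
  imports
    Complex_Main
    "HOL-Algebra.QuotRing"
    "HOL-Algebra.Elementary_Groups"
    "HOL-Algebra.Product_Groups"
    "Jordan_Normal_Form.Matrix"
begin

section \<open>The real quaternions\<close>

text \<open>\<open>Quat a b c d\<close> is \<open>a + b i + c j + d k\<close> with \<open>i j = k\<close>.\<close>

datatype quat = Quat (qRe: real) (qI: real) (qJ: real) (qK: real)

instantiation quat :: real_algebra_1
begin

definition "0 = Quat 0 0 0 0"
definition "1 = Quat 1 0 0 0"
definition "x + y = Quat (qRe x + qRe y) (qI x + qI y) (qJ x + qJ y) (qK x + qK y)"
definition "- x = Quat (- qRe x) (- qI x) (- qJ x) (- qK x)"
definition "x - y = Quat (qRe x - qRe y) (qI x - qI y) (qJ x - qJ y) (qK x - qK y)"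
definition "r *\<^sub>R x = Quat (r * qRe x) (r * qI x) (r * qJ x) (r * qK x)"
definition "x * y = Quat
  (qRe x * qRe y - qI x * qI y - qJ x * qJ y - qK x * qK y)
  (qRe x * qI y + qI x * qRe y + qJ x * qK y - qK x * qJ y)
  (qRe x * qJ y - qI x * qK y + qJ x * qRe y + qK x * qI y)
  (qRe x * qK y + qI x * qJ y - qJ x * qI y + qK x * qRe y)"

instance
  by intro_classes
    (auto simp: zero_quat_def one_quat_def plus_quat_def uminus_quat_def minus_quat_def
      scaleR_quat_def times_quat_def algebra_simps)

end


section \<open>Real algebras as records\<close>

text \<open>The square matrices of size \<open>n\<close> form a carrier set rather than a type. For a common
  notion of isomorphism, real algebras are packaged in the record type
  \<open>(real, 'b) module\<close>, which has the ring operations and a scalar multiplication.\<close>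

definition type_algebra :: "'a::real_algebra_1 itself \<Rightarrow> (real, 'a) module" where
  "type_algebra _ = \<lparr>carrier = UNIV, monoid.mult = (*), one = 1, zero = 0, add = (+), smult = scaleR\<rparr>"

definition mat_algebra :: "'b::real_algebra_1 itself \<Rightarrow> nat \<Rightarrow> (real, 'b mat) module" where
  "mat_algebra _ n = \<lparr>carrier = carrier_mat n n, monoid.mult = (*), one = 1\<^sub>m n, zero = 0\<^sub>m n n,
     add = (+), smult = (\<lambda>r. map_mat (scaleR r))\<rparr>"

definition prod_algebra ::
  "(real, 'a) module \<Rightarrow> (real, 'b) module \<Rightarrow> (real, 'a \<times> 'b) module" where
  "prod_algebra A B = \<lparr>carrier = carrier A \<times> carrier B,
     monoid.mult = (\<lambda>(a, b) (a', b'). (a \<otimes>\<^bsub>A\<^esub> a', b \<otimes>\<^bsub>B\<^esub> b')),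
     one = (\<one>\<^bsub>A\<^esub>, \<one>\<^bsub>B\<^esub>), zero = (\<zero>\<^bsub>A\<^esub>, \<zero>\<^bsub>B\<^esub>),
     add = (\<lambda>(a, b) (a', b'). (a \<oplus>\<^bsub>A\<^esub> a', b \<oplus>\<^bsub>B\<^esub> b')),
     smult = (\<lambda>r (a, b). (r \<odot>\<^bsub>A\<^esub> a, r \<odot>\<^bsub>B\<^esub> b))\<rparr>"

definition algebra_isomorphic :: "(real, 'a) module \<Rightarrow> (real, 'b) module \<Rightarrow> bool"
    (infix \<open>\<cong>\<^sub>a\<close> 50) where
  "A \<cong>\<^sub>a B \<longleftrightarrow>
     (\<exists>f \<in> ring_iso A B. \<forall>r. \<forall>x \<in> carrier A. f (r \<odot>\<^bsub>A\<^esub> x) = r \<odot>\<^bsub>B\<^esub> f x)"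

definition finite_dimensional :: "'a::real_vector itself \<Rightarrow> bool" where
  "finite_dimensional _ \<longleftrightarrow> (\<exists>B :: 'a set. finite B \<and> span B = UNIV)"

definition algebra_center :: "'a::real_algebra_1 set" where
  "algebra_center = {z. \<forall>x. z * x = x * z}"


section \<open>Gradings\<close>

definition direct_sum_decomposition ::
  "'g set \<Rightarrow> ('g \<Rightarrow> 'a::real_vector set) \<Rightarrow> bool" where
  "direct_sum_decomposition I V \<longleftrightarrow>
     (\<forall>g\<in>I. subspace (V g)) \<and>
     (\<forall>x. \<exists>!f. (\<forall>g\<in>I. f g \<in> V g) \<and> (\<forall>g. g \<notin> I \<longrightarrow> f g = 0) \<and>
        finite {g. f g \<noteq> 0} \<and> x = (\<Sum>g | f g \<noteq> 0. f g))"

definition grading ::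
  "('g, 'm) monoid_scheme \<Rightarrow> ('g \<Rightarrow> 'a::real_algebra_1 set) \<Rightarrow> bool" where
  "grading G D \<longleftrightarrow> group G \<and> direct_sum_decomposition (carrier G) D \<and>
     (\<forall>g\<in>carrier G. \<forall>h\<in>carrier G. \<forall>x\<in>D g. \<forall>y\<in>D h. x * y \<in> D (g \<otimes>\<^bsub>G\<^esub> h))"

definition grading_support ::
  "('g, 'm) monoid_scheme \<Rightarrow> ('g \<Rightarrow> 'a::real_algebra_1 set) \<Rightarrow> 'g set" where
  "grading_support G D = {g \<in> carrier G. D g \<noteq> {0}}"

definition division_grading ::
  "('g, 'm) monoid_scheme \<Rightarrow> ('g \<Rightarrow> 'a::real_algebra_1 set) \<Rightarrow> bool" where
  "division_grading G D \<longleftrightarrow> grading G D \<and>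
     (\<forall>g\<in>carrier G. \<forall>x\<in>D g. x \<noteq> 0 \<longrightarrow> (\<exists>y. x * y = 1 \<and> y * x = 1))"


section \<open>Quadratic forms and the Arf invariant\<close>

definition alternating_bicharacter ::
  "('g, 'm) monoid_scheme \<Rightarrow> ('g \<Rightarrow> 'g \<Rightarrow> real) \<Rightarrow> bool" where
  "alternating_bicharacter T \<beta> \<longleftrightarrow>
     (\<forall>u\<in>carrier T. \<forall>v\<in>carrier T. \<beta> u v \<noteq> 0) \<and>
     (\<forall>u\<in>carrier T. \<forall>v\<in>carrier T. \<forall>w\<in>carrier T. \<beta> (u \<otimes>\<^bsub>T\<^esub> v) w = \<beta> u w * \<beta> v w) \<and>
     (\<forall>u\<in>carrier T. \<forall>v\<in>carrier T. \<forall>w\<in>carrier T. \<beta> u (v \<otimes>\<^bsub>T\<^esub> w) = \<beta> u v * \<beta> u w) \<and>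
     (\<forall>u\<in>carrier T. \<beta> u u = 1)"

definition quadratic_form :: "('g, 'm) monoid_scheme \<Rightarrow> ('g \<Rightarrow> real) \<Rightarrow> bool" where
  "quadratic_form T \<mu> \<longleftrightarrow> (\<forall>t\<in>carrier T. \<mu> t \<in> {1, -1}) \<and>
     alternating_bicharacter T (\<lambda>u v. \<mu> (u \<otimes>\<^bsub>T\<^esub> v) * inverse (\<mu> u) * inverse (\<mu> v))"

definition Arf :: "'g set \<Rightarrow> ('g \<Rightarrow> real) \<Rightarrow> int" where
  "Arf T \<mu> = sgn (int (card {t \<in> T. \<mu> t = 1}) - int (card {t \<in> T. \<mu> t = -1}))"

definition elementary_2_group :: "nat \<Rightarrow> (nat \<Rightarrow> int) monoid" where
  "elementary_2_group N = product_group {..<N} (\<lambda>_. integer_mod_group 2)"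

end

theory Submission
  imports Defs
begin

text \<open>Each \<open>X\<^sub>s X\<^sub>t\<close> is \<open>\<plusminus> X\<^sub>s\<^sub>t\<close>, so two basis elements commute or anticommute according to the polar
  form \<open>\<beta>\<close> of \<open>\<mu>\<close>. Two anticommuting elements \<open>X\<^sub>a, X\<^sub>b\<close> with \<open>\<mu> a = 1\<close> generate a copy of
  \<open>M\<^sub>2(\<real>)\<close>, whose commutant is spanned by the \<open>X\<^sub>t\<close> with \<open>t\<close> orthogonal to \<open>a\<close> and \<open>b\<close>; splitting off
  \<open>{a, b}\<close> divides the order of the group by 4 and the sum of \<open>\<mu>\<close> by 2 and preserves the radical.
  Once no such pair is left, what remains is either the radical itself, spanning
  \<open>\<real>\<close>, \<open>\<real> \<times> \<real>\<close> or \<open>\<complex>\<close>, or the product of the radical and a quaternion basis, in which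
  case \<open>\<mu> = 1\<close> on the radical and the span is the quaternion algebra or a product of two copies.
  The sign of the sum of \<open>\<mu>\<close> and the order of
  the radical tell the cases apart.\<close>

section \<open>Matrix units\<close>

text \<open>The number of splittings is not known in advance, so no type of iterated tensor products
  can be formed. Everything therefore stays inside the given algebra: an algebra with a system of
  \<open>n\<close> by \<open>n\<close> matrix units is the full matrix algebra over the commutant of
  that system. Each splitting enlarges the system and shrinks the commutant, and only the last
  commutant is compared with a concrete algebra.

  The condition \<open>\<mu> a = 1\<close> supplies the idempotents
  \<open>(1 \<plusminus> X a) / 2\<close>; either sign of \<open>\<mu> b\<close> is absorbed by
  rescaling one unit. On the four elements \<open>t\<close>, \<open>a t\<close>, \<open>b t\<close>,
  \<open>a b t\<close> with \<open>t\<close> orthogonal to the pair, \<open>\<mu>\<close> adds up to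
  \<open>1 + \<mu> a + \<mu> b - \<mu> a * \<mu> b\<close> times \<open>\<mu> t\<close>. This factor
  is 2 while \<open>\<mu> a = 1\<close> and -2 when both signs are -1, which is where the negative
  Arf invariant comes from.

  The center has the \<open>X t\<close> with \<open>t\<close> in the radical as a basis, so the
  radical has order 1 or 2. The last group then has order 1, 2, 4 or 8, and since each splitting
  divides the order by 4, the parity of \<open>N\<close> is that of the logarithm of this last
  order.\<close>

definition commutant :: "'a::times set \<Rightarrow> 'a set" where
  "commutant S = {x. \<forall>s\<in>S. x * s = s * x}"

definition matrix_units :: "nat \<Rightarrow> (nat \<Rightarrow> nat \<Rightarrow> 'a::real_algebra_1) \<Rightarrow> bool" where
  "matrix_units n e \<longleftrightarrow>
     (\<forall>i<n. \<forall>j<n. \<forall>k<n. \<forall>l<n. e i j * e k l = (if j = k then e i l else 0)) \<and>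
     (\<Sum>i<n. e i i) = 1"

definition unit_set :: "nat \<Rightarrow> (nat \<Rightarrow> nat \<Rightarrow> 'a) \<Rightarrow> 'a set" where
  "unit_set n e = {e i j | i j. i < n \<and> j < n}"

text \<open>The entry of \<open>x\<close> in row \<open>i\<close> and column \<open>j\<close>, as an
  element of the commutant: the corner \<open>e i i * x * e j j\<close> is carried to each diagonal
  place \<open>k\<close> and the copies are added.\<close>

definition unit_coord :: "nat \<Rightarrow> (nat \<Rightarrow> nat \<Rightarrow> 'a::real_algebra_1) \<Rightarrow> 'a \<Rightarrow> nat \<Rightarrow> nat \<Rightarrow> 'a" where
  "unit_coord n e x i j = (\<Sum>k<n. e k i * x * e j k)"

text \<open>Relative to a set because a commutant is not a type; in the uses \<open>C\<close> is a
  commutant or \<open>UNIV\<close>.\<close>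

definition algebra_hom_on :: "'a::real_algebra_1 set \<Rightarrow> ('a \<Rightarrow> 'b::real_algebra_1) \<Rightarrow> bool" where
  "algebra_hom_on C \<phi> \<longleftrightarrow> \<phi> 1 = 1 \<and>
     (\<forall>x\<in>C. \<forall>y\<in>C. \<phi> (x + y) = \<phi> x + \<phi> y \<and> \<phi> (x * y) = \<phi> x * \<phi> y) \<and>
     (\<forall>r. \<forall>x\<in>C. \<phi> (r *\<^sub>R x) = r *\<^sub>R \<phi> x)"

lemma commutant_one: "1 \<in> commutant (S :: 'a::real_algebra_1 set)"
  by (simp add: commutant_def)

lemma commutant_mult: "x \<in> commutant S \<Longrightarrow> y \<in> commutant S \<Longrightarrow> x * y \<in> commutant S"
  for x y :: "'a::real_algebra_1"
  by (simp add: commutant_def) (metis mult.assoc)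

lemma subspace_commutant: "subspace (commutant (S :: 'a::real_algebra_1 set))"
  by (simp add: commutant_def subspace_def algebra_simps)

lemma subspace_algebra_hom_range:
  assumes "algebra_hom_on UNIV \<psi>"
  shows "subspace (range \<psi>)"
  unfolding subspace_def
proof (intro conjI ballI allI)
  have "\<psi> (0 *\<^sub>R 1) = 0"
    using assms unfolding algebra_hom_on_def by (metis UNIV_I scaleR_zero_left)
  then show "0 \<in> range \<psi>"
    by (metis rangeI)
next
  fix x y assume "x \<in> range \<psi>" "y \<in> range \<psi>"
  then obtain a b where "x = \<psi> a" "y = \<psi> b" by blast
  then have "x + y = \<psi> (a + b)"
    using assms by (simp add: algebra_hom_on_def)
  then show "x + y \<in> range \<psi>" by blast
next
  fix r x assume "x \<in> range \<psi>"
  then obtain a where "x = \<psi> a" by blast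
  then have "r *\<^sub>R x = \<psi> (r *\<^sub>R a)"
    using assms by (simp add: algebra_hom_on_def)
  then show "r *\<^sub>R x \<in> range \<psi>" by blast
qed

section \<open>Coordinates with respect to a system of matrix units\<close>

context
  fixes n :: nat and e :: "nat \<Rightarrow> nat \<Rightarrow> 'a::real_algebra_1"
  assumes mu: "matrix_units n e"
begin

lemma units_mult:
  "i < n \<Longrightarrow> j < n \<Longrightarrow> k < n \<Longrightarrow> l < n \<Longrightarrow> e i j * e k l = (if j = k then e i l else 0)"
  using mu by (simp add: matrix_units_def)

lemma units_sum: "(\<Sum>i<n. e i i) = 1"
  using mu by (simp add: matrix_units_def)

text \<open>Multiplication by \<open>e a b\<close> on either side leaves a single summand,
  \<open>k = a\<close> on the right and \<open>k = b\<close> on the left, and both times it is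
  \<open>e a i * x * e j b\<close>.\<close>

lemma unit_coord_in_commutant:
  assumes "i < n" "j < n"
  shows "unit_coord n e x i j \<in> commutant (unit_set n e)"
proof -
  have "unit_coord n e x i j * e a b = e a b * unit_coord n e x i j" if "a < n" "b < n" for a b
  proof -
    have "unit_coord n e x i j * e a b = (\<Sum>k<n. if k = a then e a i * x * e j b else 0)"
      unfolding unit_coord_def sum_distrib_right
      using assms that by (intro sum.cong refl) (auto simp: mult.assoc units_mult)
    also have "\<dots> = (\<Sum>k<n. if k = b then e a i * x * e j b else 0)"
      using that by simp
    also have "\<dots> = e a b * unit_coord n e x i j"
      unfolding unit_coord_def sum_distrib_left
      using assms that by (intro sum.cong refl) (auto simp: mult.assoc[symmetric] units_mult)
    finally show ?thesis .
  qed
  then show ?thesis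
    by (auto simp: commutant_def unit_set_def)
qed

lemma unit_coord_add: "unit_coord n e (x + y) i j = unit_coord n e x i j + unit_coord n e y i j"
  by (simp add: unit_coord_def algebra_simps sum.distrib)

lemma unit_coord_scaleR: "unit_coord n e (r *\<^sub>R x) i j = r *\<^sub>R unit_coord n e x i j"
  by (simp add: unit_coord_def scaleR_sum_right)

lemma unit_coord_sum: "unit_coord n e (sum f S) i j = (\<Sum>s\<in>S. unit_coord n e (f s) i j)"
  unfolding unit_coord_def sum_distrib_left sum_distrib_right by (rule sum.swap)

lemma unit_coord_one:
  assumes "i < n" "j < n"
  shows "unit_coord n e 1 i j = (if i = j then 1 else 0)"
proof -
  have "unit_coord n e 1 i j = (\<Sum>k<n. if i = j then e k k else 0)"
    unfolding unit_coord_def using assms by (intro sum.cong refl) (auto simp: units_mult)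
  then show ?thesis
    by (simp add: units_sum)
qed

text \<open>Matrix multiplication arises from inserting \<open>1 = (\<Sum>l<n. e l l)\<close>
  between \<open>x\<close> and \<open>y\<close>; in a product of two coordinates the inner factor
  \<open>e l k * e k' l\<close> removes all terms with \<open>k \<noteq> k'\<close>.\<close>

lemma unit_coord_mult:
  assumes "i < n" "j < n"
  shows "unit_coord n e (x * y) i j = (\<Sum>l<n. unit_coord n e x i l * unit_coord n e y l j)"
proof -
  have *: "unit_coord n e x i l * unit_coord n e y l j = (\<Sum>k<n. e k i * x * e l l * y * e j k)"
    if "l < n" for l
  proof -
    have "unit_coord n e x i l * unit_coord n e y l j =
      (\<Sum>k<n. \<Sum>k'<n. (e k i * x * e l k) * (e k' l * y * e j k'))"
      by (simp add: unit_coord_def sum_product)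
    also have "\<dots> = (\<Sum>k<n. \<Sum>k'<n. if k = k' then e k i * x * e l l * y * e j k else 0)"
    proof (intro sum.cong refl)
      fix k k' assume "k \<in> {..<n}" "k' \<in> {..<n}"
      then have "e l k * e k' l = (if k = k' then e l l else 0)"
        using that by (simp add: units_mult)
      moreover have "(e k i * x * e l k) * (e k' l * y * e j k') =
          e k i * x * (e l k * e k' l) * y * e j k'"
        by (simp add: mult.assoc)
      ultimately show "(e k i * x * e l k) * (e k' l * y * e j k') =
          (if k = k' then e k i * x * e l l * y * e j k else 0)"
        by simp
    qed
    finally show ?thesis
      by (simp cong: if_cong)
  qed
  have "(\<Sum>l<n. unit_coord n e x i l * unit_coord n e y l j) =
      (\<Sum>l<n. \<Sum>k<n. e k i * x * e l l * y * e j k)"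
    using * by simp
  also have "\<dots> = (\<Sum>k<n. \<Sum>l<n. e k i * x * e l l * y * e j k)"
    by (rule sum.swap)
  also have "\<dots> = (\<Sum>k<n. e k i * x * (\<Sum>l<n. e l l) * y * e j k)"
    by (simp add: sum_distrib_left sum_distrib_right)
  finally show ?thesis
    by (simp add: units_sum unit_coord_def mult.assoc)
qed

lemma unit_coord_expand: "x = (\<Sum>i<n. \<Sum>j<n. unit_coord n e x i j * e i j)"
proof -
  have *: "unit_coord n e x i j * e i j = e i i * x * e j j" if "i < n" "j < n" for i j
  proof -
    have "unit_coord n e x i j * e i j = (\<Sum>k<n. if k = i then e i i * x * e j j else 0)"
      unfolding unit_coord_def sum_distrib_right
      using that by (intro sum.cong refl) (auto simp: mult.assoc units_mult)
    then show ?thesis using that by simp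
  qed
  have "(\<Sum>i<n. \<Sum>j<n. unit_coord n e x i j * e i j) = (\<Sum>i<n. \<Sum>j<n. e i i * x * e j j)"
    using * by simp
  also have "\<dots> = (\<Sum>i<n. e i i) * x * (\<Sum>j<n. e j j)"
    by (simp add: sum_distrib_left sum_distrib_right) (rule sum.swap)
  finally show ?thesis
    by (simp add: units_sum)
qed

text \<open>Uniqueness of the coordinates, from which surjectivity of \<open>coord_mat\<close>
  follows: coefficients in the commutant can be pulled in front of the units, and
  \<open>e k i * e a b * e j k\<close> is \<open>e k k\<close> or 0.\<close>

lemma unit_coord_combination:
  assumes "\<And>i j. i < n \<Longrightarrow> j < n \<Longrightarrow> c i j \<in> commutant (unit_set n e)" and "i < n" "j < n"
  shows "unit_coord n e (\<Sum>a<n. \<Sum>b<n. c a b * e a b) i j = c i j"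
proof -
  have *: "unit_coord n e (c a b * e a b) i j = (if i = a then if b = j then c i j else 0 else 0)"
    if "a < n" "b < n" for a b
  proof -
    have "e k i * (c a b * e a b) * e j k =
        (if i = a then if b = j then c i j * e k k else 0 else 0)" if "k < n" for k
    proof -
      have "e k i * (c a b * e a b) * e j k = c a b * (e k i * e a b * e j k)"
      proof -
        have "c a b * e k i = e k i * c a b"
          using assms(1)[OF \<open>a < n\<close> \<open>b < n\<close>] assms(2) \<open>k < n\<close>
          by (auto simp: commutant_def unit_set_def)
        then show ?thesis
          by (metis mult.assoc)
      qed
      then show ?thesis
        using assms \<open>a < n\<close> \<open>b < n\<close> \<open>k < n\<close> by (auto simp: units_mult)
    qed
    then have "unit_coord n e (c a b * e a b) i j =
        (\<Sum>k<n. if i = a then if b = j then c i j * e k k else 0 else 0)"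
      unfolding unit_coord_def by (intro sum.cong) auto
    then show ?thesis
      by (auto simp: units_sum simp flip: sum_distrib_left)
  qed
  have "unit_coord n e (\<Sum>a<n. \<Sum>b<n. c a b * e a b) i j =
      (\<Sum>a<n. \<Sum>b<n. if i = a then if b = j then c i j else 0 else 0)"
    by (simp add: unit_coord_sum *)
  also have "\<dots> = (\<Sum>a<n. if i = a then c i j else 0)"
    using assms(3) by (intro sum.cong) auto
  finally show ?thesis
    using assms(2) by simp
qed

definition coord_mat :: "('a \<Rightarrow> 'k) \<Rightarrow> 'a \<Rightarrow> 'k mat" where
  "coord_mat \<phi> x = mat n n (\<lambda>(i, j). \<phi> (unit_coord n e x i j))"

lemma coord_mat_carrier: "coord_mat \<phi> x \<in> carrier_mat n n"
  by (simp add: coord_mat_def)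

lemma coord_mat_eqD:
  "coord_mat \<phi> x = coord_mat \<phi> y \<Longrightarrow> i < n \<Longrightarrow> j < n \<Longrightarrow>
    \<phi> (unit_coord n e x i j) = \<phi> (unit_coord n e y i j)"
  unfolding coord_mat_def by (drule arg_cong[where f = "\<lambda>M. M $$ (i, j)"]) simp

lemma coord_mat_hom:
  fixes \<phi> :: "'a \<Rightarrow> 'k::real_algebra_1"
  assumes \<phi>: "algebra_hom_on (commutant (unit_set n e)) \<phi>"
  shows "coord_mat \<phi> (x * y) = coord_mat \<phi> x * coord_mat \<phi> y"
    and "coord_mat \<phi> (x + y) = coord_mat \<phi> x + coord_mat \<phi> y"
    and "coord_mat \<phi> 1 = 1\<^sub>m n"
    and "coord_mat \<phi> (r *\<^sub>R x) = map_mat (scaleR r) (coord_mat \<phi> x)"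
proof -
  let ?C = "commutant (unit_set n e)"
  have one: "\<phi> 1 = 1"
    using \<phi> by (simp add: algebra_hom_on_def)
  have hom: "\<phi> (x + y) = \<phi> x + \<phi> y" "\<phi> (x * y) = \<phi> x * \<phi> y"
    if "x \<in> ?C" "y \<in> ?C" for x y
    using \<phi> that by (simp_all add: algebra_hom_on_def)
  have hom_scaleR: "\<phi> (r *\<^sub>R x) = r *\<^sub>R \<phi> x" if "x \<in> ?C" for x r
    using \<phi> that by (simp add: algebra_hom_on_def)
  have zero: "\<phi> 0 = 0"
    using hom_scaleR[of 1 0] by (simp add: commutant_one)
  \<comment> \<open>Additivity is available on the commutant only, so each partial sum has to be
    shown to stay there.\<close>
  have sum: "\<phi> (sum f S) = (\<Sum>s\<in>S. \<phi> (f s))" if "finite S" "\<And>s. s \<in> S \<Longrightarrow> f s \<in> ?C"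
    for f :: "nat \<Rightarrow> 'a" and S
    using that
  proof (induction S)
    case (insert s S)
    then have "sum f S \<in> ?C"
      by (intro subspace_sum subspace_commutant) auto
    then show ?case
      using insert by (simp add: hom)
  qed (simp add: zero)
  show "coord_mat \<phi> (x * y) = coord_mat \<phi> x * coord_mat \<phi> y"
  proof (rule eq_matI)
    fix i j assume "i < dim_row (coord_mat \<phi> x * coord_mat \<phi> y)"
      "j < dim_col (coord_mat \<phi> x * coord_mat \<phi> y)"
    then have ij: "i < n" "j < n" by (simp_all add: coord_mat_def)
    have "\<phi> (unit_coord n e (x * y) i j) =
        (\<Sum>l<n. \<phi> (unit_coord n e x i l) * \<phi> (unit_coord n e y l j))"
      unfolding unit_coord_mult[OF ij] using ij
      by (subst sum) (simp_all add: commutant_mult unit_coord_in_commutant hom)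
    then show "coord_mat \<phi> (x * y) $$ (i, j) = (coord_mat \<phi> x * coord_mat \<phi> y) $$ (i, j)"
      using ij by (simp add: coord_mat_def scalar_prod_def lessThan_atLeast0)
  qed (simp_all add: coord_mat_def)
  show "coord_mat \<phi> (x + y) = coord_mat \<phi> x + coord_mat \<phi> y"
    by (rule eq_matI) (simp_all add: coord_mat_def unit_coord_add unit_coord_in_commutant hom)
  show "coord_mat \<phi> 1 = 1\<^sub>m n"
    by (rule eq_matI) (auto simp: coord_mat_def unit_coord_one zero one)
  show "coord_mat \<phi> (r *\<^sub>R x) = map_mat (scaleR r) (coord_mat \<phi> x)"
    by (rule eq_matI) (simp_all add: coord_mat_def unit_coord_scaleR unit_coord_in_commutant hom_scaleR)
qed

lemma unit_coord_inj:
  assumes "\<And>i j. i < n \<Longrightarrow> j < n \<Longrightarrow> unit_coord n e x i j = unit_coord n e y i j"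
  shows "x = y"
proof -
  have "x = (\<Sum>i<n. \<Sum>j<n. unit_coord n e x i j * e i j)"
    by (rule unit_coord_expand)
  also have "\<dots> = (\<Sum>i<n. \<Sum>j<n. unit_coord n e y i j * e i j)"
    using assms by simp
  also have "\<dots> = y"
    by (rule unit_coord_expand[symmetric])
  finally show ?thesis .
qed

lemma isomorphic_mat_algebra:
  fixes \<phi> :: "'a \<Rightarrow> 'k::real_algebra_1"
  assumes hom: "algebra_hom_on (commutant (unit_set n e)) \<phi>"
    and bij: "bij_betw \<phi> (commutant (unit_set n e)) UNIV"
  shows "type_algebra TYPE('a) \<cong>\<^sub>a mat_algebra TYPE('k) n"
proof -
  let ?C = "commutant (unit_set n e)"
  have "inj (coord_mat \<phi>)"
  proof (rule injI)
    fix x y assume "coord_mat \<phi> x = coord_mat \<phi> y"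
    then show "x = y"
      by - (rule unit_coord_inj, rule inj_onD[OF bij_betw_imp_inj_on[OF bij]],
        auto simp: unit_coord_in_commutant dest: coord_mat_eqD)
  qed
  moreover have "M \<in> range (coord_mat \<phi>)" if "M \<in> carrier_mat n n" for M
  proof -
    have "\<exists>c\<in>?C. \<phi> c = M $$ (i, j)" for i j
    proof -
      have "M $$ (i, j) \<in> \<phi> ` ?C"
        by (simp add: bij_betw_imp_surj_on[OF bij])
      then show ?thesis by auto
    qed
    then obtain c where c: "\<And>i j. c i j \<in> ?C \<and> \<phi> (c i j) = M $$ (i, j)"
      by metis
    have "coord_mat \<phi> (\<Sum>a<n. \<Sum>b<n. c a b * e a b) = M"
      using that by (intro eq_matI) (simp_all add: c coord_mat_def unit_coord_combination)
    then show ?thesis by blast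
  qed
  ultimately have "bij_betw (coord_mat \<phi>) UNIV (carrier_mat n n)"
    by (auto simp: bij_betw_def coord_mat_carrier)
  moreover have "coord_mat \<phi> \<in> Ring.ring_hom (type_algebra TYPE('a)) (mat_algebra TYPE('k) n)"
    by (rule ring_hom_memI)
      (simp_all add: type_algebra_def mat_algebra_def coord_mat_hom[OF hom] coord_mat_carrier)
  ultimately show ?thesis
    unfolding algebra_isomorphic_def ring_iso_def
    by (intro bexI[of _ "coord_mat \<phi>"])
      (simp_all add: type_algebra_def mat_algebra_def coord_mat_hom[OF hom])
qed

lemma isomorphic_prod_mat_algebra:
  fixes \<phi> :: "'a \<Rightarrow> 'k::real_algebra_1" and \<phi>' :: "'a \<Rightarrow> 'l::real_algebra_1"
  assumes hom: "algebra_hom_on (commutant (unit_set n e)) \<phi>"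
      "algebra_hom_on (commutant (unit_set n e)) \<phi>'"
    and bij: "bij_betw (\<lambda>x. (\<phi> x, \<phi>' x)) (commutant (unit_set n e)) UNIV"
  shows "type_algebra TYPE('a) \<cong>\<^sub>a prod_algebra (mat_algebra TYPE('k) n) (mat_algebra TYPE('l) n)"
proof -
  let ?C = "commutant (unit_set n e)"
  let ?F = "\<lambda>x. (coord_mat \<phi> x, coord_mat \<phi>' x)"
  have "inj ?F"
  proof (rule injI)
    fix x y assume eq: "?F x = ?F y"
    show "x = y"
    proof (rule unit_coord_inj)
      fix i j assume ij: "i < n" "j < n"
      then have "(\<phi> (unit_coord n e x i j), \<phi>' (unit_coord n e x i j)) =
          (\<phi> (unit_coord n e y i j), \<phi>' (unit_coord n e y i j))"
        using eq by (auto dest: coord_mat_eqD)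
      then show "unit_coord n e x i j = unit_coord n e y i j"
        by (rule inj_onD[OF bij_betw_imp_inj_on[OF bij]]) (simp_all add: ij unit_coord_in_commutant)
    qed
  qed
  moreover have "(M, M') \<in> range ?F" if "M \<in> carrier_mat n n" "M' \<in> carrier_mat n n" for M M'
  proof -
    have "\<exists>c\<in>?C. \<phi> c = M $$ (i, j) \<and> \<phi>' c = M' $$ (i, j)" for i j
    proof -
      have "(M $$ (i, j), M' $$ (i, j)) \<in> (\<lambda>x. (\<phi> x, \<phi>' x)) ` ?C"
        by (simp add: bij_betw_imp_surj_on[OF bij])
      then show ?thesis by auto
    qed
    then obtain c where c: "\<And>i j. c i j \<in> ?C \<and> \<phi> (c i j) = M $$ (i, j) \<and> \<phi>' (c i j) = M' $$ (i, j)"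
      by metis
    have "coord_mat \<phi> (\<Sum>a<n. \<Sum>b<n. c a b * e a b) = M"
        "coord_mat \<phi>' (\<Sum>a<n. \<Sum>b<n. c a b * e a b) = M'"
      using that by (intro eq_matI; simp add: c coord_mat_def unit_coord_combination)+
    then show ?thesis
      by (intro image_eqI[of _ _ "\<Sum>a<n. \<Sum>b<n. c a b * e a b"]) simp_all
  qed
  ultimately have "bij_betw ?F UNIV (carrier_mat n n \<times> carrier_mat n n)"
    by (auto simp: bij_betw_def coord_mat_carrier)
  moreover have "?F \<in> Ring.ring_hom (type_algebra TYPE('a))
      (prod_algebra (mat_algebra TYPE('k) n) (mat_algebra TYPE('l) n))"
    by (rule ring_hom_memI)
      (simp_all add: type_algebra_def mat_algebra_def prod_algebra_def
        coord_mat_hom[OF hom(1)] coord_mat_hom[OF hom(2)] coord_mat_carrier)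
  ultimately show ?thesis
    unfolding algebra_isomorphic_def ring_iso_def
    by (intro bexI[of _ ?F])
      (simp_all add: type_algebra_def mat_algebra_def prod_algebra_def
        coord_mat_hom[OF hom(1)] coord_mat_hom[OF hom(2)])
qed

end

section \<open>Commutants given by a division algebra, alone or doubled\<close>

lemma algebra_hom_diff:
  assumes "algebra_hom_on UNIV \<psi>"
  shows "\<psi> (x - y) = \<psi> x - \<psi> y"
proof -
  have "\<psi> (x + (-1) *\<^sub>R y) = \<psi> x + (-1) *\<^sub>R \<psi> y"
    using assms unfolding algebra_hom_on_def by (metis UNIV_I)
  then show ?thesis by simp
qed

text \<open>The element \<open>w\<close> may be a zero divisor, as the idempotents
  \<open>(1 \<plusminus> z) / 2\<close> below are: a left inverse of \<open>x - y\<close> turns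
  \<open>\<psi> (x - y) * w = 0\<close> into \<open>w = 0\<close>.\<close>

lemma division_hom_cancel:
  fixes \<psi> :: "'k::real_algebra_1 \<Rightarrow> 'a::real_algebra_1"
  assumes hom: "algebra_hom_on UNIV \<psi>" and div: "\<And>p::'k. p \<noteq> 0 \<Longrightarrow> \<exists>q. q * p = 1"
    and "w \<noteq> 0" and eq: "\<psi> x * w = \<psi> y * w"
  shows "x = y"
proof (rule ccontr)
  assume "x \<noteq> y"
  then obtain q where q: "q * (x - y) = 1"
    using div[of "x - y"] by auto
  have "w = \<psi> (q * (x - y)) * w"
    using hom by (simp add: q algebra_hom_on_def)
  also have "\<dots> = \<psi> q * ((\<psi> x - \<psi> y) * w)"
    using hom by (simp add: algebra_hom_on_def algebra_hom_diff[OF hom, symmetric] mult.assoc)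
  also have "\<dots> = 0"
    using eq by (simp add: algebra_simps)
  finally show False
    using \<open>w \<noteq> 0\<close> by simp
qed

text \<open>The model algebra is mapped into the given one, since \<open>\<psi>\<close> is easily
  written down in a basis; the map needed on the commutant is its inverse, with injectivity coming
  from \<open>div\<close>.\<close>

lemma isomorphic_mat_algebra_if_hom:
  fixes \<psi> :: "'k::real_algebra_1 \<Rightarrow> 'a::real_algebra_1"
  assumes mu: "matrix_units n e" and hom: "algebra_hom_on UNIV \<psi>"
    and range: "range \<psi> = commutant (unit_set n e)"
    and div: "\<And>p::'k. p \<noteq> 0 \<Longrightarrow> \<exists>q. q * p = 1"
  shows "type_algebra TYPE('a) \<cong>\<^sub>a mat_algebra TYPE('k) n"
proof (rule isomorphic_mat_algebra[OF mu])
  have inj: "inj \<psi>"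
    by (rule injI, rule division_hom_cancel[OF hom div, of 1]) auto
  show "bij_betw (inv_into UNIV \<psi>) (commutant (unit_set n e)) UNIV"
    by (rule bij_betw_inv_into) (simp add: bij_betw_def inj range)
  have inv: "inv_into UNIV \<psi> (\<psi> p) = p" for p
    using inj by simp
  have *: "inv_into UNIV \<psi> (\<psi> p + \<psi> q) = p + q" "inv_into UNIV \<psi> (\<psi> p * \<psi> q) = p * q"
      "inv_into UNIV \<psi> (r *\<^sub>R \<psi> p) = r *\<^sub>R p" "inv_into UNIV \<psi> 1 = 1" for p q r
    using inv[of "p + q"] inv[of "p * q"] inv[of "r *\<^sub>R p"] inv[of 1] hom
    by (simp_all add: algebra_hom_on_def)
  show "algebra_hom_on (commutant (unit_set n e)) (inv_into UNIV \<psi>)"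
    unfolding range[symmetric] algebra_hom_on_def by (auto simp: * inv)
qed

text \<open>The commutant is presented as \<open>K + K z\<close> with \<open>K\<close> the image of
  \<open>\<psi>\<close>. With the two idempotents as a basis over \<open>K\<close>, multiplication
  becomes componentwise; \<open>z \<noteq> 1\<close> and \<open>z \<noteq> -1\<close> keep both
  idempotents nonzero, so cancellation works in either component.\<close>

lemma isomorphic_prod_mat_algebra_if_hom:
  fixes \<psi> :: "'k::real_algebra_1 \<Rightarrow> 'a::real_algebra_1"
  assumes mu: "matrix_units n e" and hom: "algebra_hom_on UNIV \<psi>"
    and z: "z * z = 1" "z \<noteq> 1" "z \<noteq> -1" "\<And>p. z * \<psi> p = \<psi> p * z"
    and range: "range (\<lambda>(p, q). \<psi> p + \<psi> q * z) = commutant (unit_set n e)"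
    and div: "\<And>p::'k. p \<noteq> 0 \<Longrightarrow> \<exists>q. q * p = 1"
  shows "type_algebra TYPE('a) \<cong>\<^sub>a prod_algebra (mat_algebra TYPE('k) n) (mat_algebra TYPE('k) n)"
proof -
  let ?C = "commutant (unit_set n e)"
  have \<psi>: "\<psi> (p + q) = \<psi> p + \<psi> q" "\<psi> (p * q) = \<psi> p * \<psi> q" "\<psi> 1 = 1" "\<psi> (r *\<^sub>R p) = r *\<^sub>R \<psi> p"
    for p q r
    using hom by (simp_all add: algebra_hom_on_def)
  note \<psi>_diff = algebra_hom_diff[OF hom]
  \<comment> \<open>The central involution \<open>z\<close> splits the algebra by the idempotents \<open>(1 \<plusminus> z) / 2\<close>.\<close>
  define u v where "u = (1/2) *\<^sub>R (1 + z)" and "v = (1/2) *\<^sub>R (1 - z)"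
  have uv: "u * u = u" "v * v = v" "u * v = 0" "v * u = 0" "u + v = 1" "u - v = z"
    unfolding u_def v_def using z(1)
    by (simp_all add: algebra_simps flip: scaleR_add_left)
  have "u \<noteq> 0" "v \<noteq> 0"
    using z(2,3) unfolding u_def v_def by (auto simp: add_eq_0_iff)
  have comm: "u * \<psi> p = \<psi> p * u" "v * \<psi> p = \<psi> p * v" for p
    by (simp_all add: u_def v_def algebra_simps z(4))
  define \<theta> where "\<theta> = (\<lambda>(p, q). \<psi> p * u + \<psi> q * v)"
  have \<theta>_mult: "\<theta> (p, q) * \<theta> (p', q') = \<theta> (p * p', q * q')" for p q p' q'
  proof -
    have a: "\<psi> x * w * (\<psi> y * w') = \<psi> (x * y) * (w * w')" if "w \<in> {u, v}" for x y w w'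
    proof -
      have "w * \<psi> y = \<psi> y * w" using that comm by auto
      then show ?thesis by (metis \<psi>(2) mult.assoc)
    qed
    show ?thesis
      unfolding \<theta>_def by (simp add: distrib_left distrib_right a uv)
  qed
  have \<theta>_add: "\<theta> (p, q) + \<theta> (p', q') = \<theta> (p + p', q + q')" for p q p' q'
    by (simp add: \<theta>_def \<psi> algebra_simps)
  have \<theta>_scaleR: "r *\<^sub>R \<theta> (p, q) = \<theta> (r *\<^sub>R p, r *\<^sub>R q)" for r p q
    by (simp add: \<theta>_def \<psi> algebra_simps)
  have \<theta>_one: "\<theta> (1, 1) = 1"
    by (simp add: \<theta>_def \<psi> uv)
  have inj: "inj \<theta>"
  proof (rule injI, clarify)
    fix p q p' q' assume eq: "\<theta> (p, q) = \<theta> (p', q')"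
    have "\<theta> (x, y) * u = \<psi> x * u" "\<theta> (x, y) * v = \<psi> y * v" for x y
      by (simp_all add: \<theta>_def distrib_right mult.assoc uv)
    then have "\<psi> p * u = \<psi> p' * u" "\<psi> q * v = \<psi> q' * v"
      using eq by metis+
    then show "p = p' \<and> q = q'"
      using division_hom_cancel[OF hom div] \<open>u \<noteq> 0\<close> \<open>v \<noteq> 0\<close> by blast
  qed
  have "range \<theta> = range (\<lambda>(p, q). \<psi> p + \<psi> q * z)"
  proof (intro equalityI subsetI)
    fix x assume "x \<in> range \<theta>"
    then obtain p q where "x = \<theta> (p, q)" by auto
    also have "\<dots> = \<psi> ((1/2) *\<^sub>R (p + q)) + \<psi> ((1/2) *\<^sub>R (p - q)) * z"
      unfolding \<theta>_def u_def v_def \<psi> \<psi>_diff by (simp add: algebra_simps)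
    finally show "x \<in> range (\<lambda>(p, q). \<psi> p + \<psi> q * z)" by auto
  next
    fix x assume "x \<in> range (\<lambda>(p, q). \<psi> p + \<psi> q * z)"
    then obtain p q where "x = \<psi> p + \<psi> q * z" by auto
    also have "\<dots> = \<psi> p * (u + v) + \<psi> q * (u - v)"
      by (simp add: uv)
    also have "\<dots> = \<theta> (p + q, p - q)"
      by (simp add: \<theta>_def \<psi> \<psi>_diff algebra_simps)
    finally show "x \<in> range \<theta>" by auto
  qed
  then have range': "range \<theta> = ?C" using range by simp
  have inv: "inv_into UNIV \<theta> (\<theta> p) = p" for p
    using inj by simp
  have inv_one: "inv_into UNIV \<theta> 1 = (1, 1)"
    using inv[of "(1, 1)"] by (simp add: \<theta>_one)
  show ?thesis
  proof (rule isomorphic_prod_mat_algebra[OF mu])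
    show "algebra_hom_on ?C (\<lambda>x. fst (inv_into UNIV \<theta> x))" "algebra_hom_on ?C (\<lambda>x. snd (inv_into UNIV \<theta> x))"
      unfolding range'[symmetric] algebra_hom_on_def
      by (auto simp: \<theta>_mult \<theta>_add \<theta>_scaleR inv inv_one)
    have "bij_betw (inv_into UNIV \<theta>) ?C UNIV"
      by (rule bij_betw_inv_into) (simp add: bij_betw_def inj range')
    then show "bij_betw (\<lambda>x. (fst (inv_into UNIV \<theta> x), snd (inv_into UNIV \<theta> x))) ?C UNIV"
      by simp
  qed
qed

section \<open>Kronecker products of matrix units and the units of an anticommuting pair\<close>

lemma all_less_2: "(\<forall>i<2. P i) \<longleftrightarrow> P 0 \<and> P (1::nat)"
  by (auto simp: less_2_cases_iff)

text \<open>The index \<open>i\<close> encodes the pair \<open>(i div 2, i mod 2)\<close>, so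
  \<open>g\<close> is the Kronecker product of the two systems; as the systems commute, products of
  units are computed in each factor separately.\<close>

lemma matrix_units_double:
  fixes e f :: "nat \<Rightarrow> nat \<Rightarrow> 'a::real_algebra_1"
  defines "g \<equiv> \<lambda>i j. e (i div 2) (j div 2) * f (i mod 2) (j mod 2)"
  assumes e: "matrix_units n e" and f: "matrix_units 2 f"
    and comm: "unit_set 2 f \<subseteq> commutant (unit_set n e)"
  shows "matrix_units (2 * n) g"
    and "commutant (unit_set (2 * n) g) = commutant (unit_set n e) \<inter> commutant (unit_set 2 f)"
proof -
  have fe: "f a b * e i j = e i j * f a b" if "a < 2" "b < 2" "i < n" "j < n" for a b i j
    using comm that by (fastforce simp: unit_set_def commutant_def)
  have sum2: "(\<Sum>i<2 * n. h i) = (\<Sum>i<n. h (2 * i) + h (2 * i + 1))" for h :: "nat \<Rightarrow> 'a"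
    by (induction n) (simp_all add: add.assoc)
  have f1: "f 0 0 + f 1 1 = 1"
    using f by (simp add: matrix_units_def numeral_2_eq_2)
  show "matrix_units (2 * n) g"
    unfolding matrix_units_def
  proof (intro conjI allI impI)
    fix i j k l assume lt: "i < 2 * n" "j < 2 * n" "k < 2 * n" "l < 2 * n"
    then have d: "i div 2 < n" "j div 2 < n" "k div 2 < n" "l div 2 < n" by auto
    have "g i j * g k l = (e (i div 2) (j div 2) * e (k div 2) (l div 2)) *
        (f (i mod 2) (j mod 2) * f (k mod 2) (l mod 2))"
      unfolding g_def using fe[of "i mod 2" "j mod 2" "k div 2" "l div 2"] d
      by (simp add: mult.assoc) (simp flip: mult.assoc)
    also have "\<dots> = (if j div 2 = k div 2 \<and> j mod 2 = k mod 2 then g i l else 0)"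
      using d by (simp add: units_mult[OF e] units_mult[OF f] g_def)
    also have "(j div 2 = k div 2 \<and> j mod 2 = k mod 2) \<longleftrightarrow> j = k"
      by (metis div_mult_mod_eq)
    finally show "g i j * g k l = (if j = k then g i l else 0)" .
  next
    show "(\<Sum>i<2 * n. g i i) = 1"
      unfolding sum2 using units_sum[OF e] f1
      by (simp add: g_def flip: distrib_left sum_distrib_right)
  qed
  \<comment> \<open>Inserting \<open>1 = f 0 0 + f 1 1\<close> recovers \<open>e i j\<close> from
    the units \<open>g\<close>, and summing over the diagonal of \<open>e\<close> recovers
    \<open>f a b\<close>; so commuting with all of \<open>g\<close> is as strong as commuting with
    both systems.\<close>
  have e_eq: "e i j = g (2 * i) (2 * j) + g (2 * i + 1) (2 * j + 1)" for i j
    using f1 by (simp add: g_def flip: distrib_left)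
  have f_eq: "f a b = (\<Sum>i<n. g (2 * i + a) (2 * i + b))" if "a < 2" "b < 2" for a b
    using that units_sum[OF e] by (simp add: g_def flip: sum_distrib_right)
  show "commutant (unit_set (2 * n) g) = commutant (unit_set n e) \<inter> commutant (unit_set 2 f)"
  proof (intro equalityI subsetI)
    fix x assume "x \<in> commutant (unit_set (2 * n) g)"
    then have x: "x * g i j = g i j * x" if "i < 2 * n" "j < 2 * n" for i j
      using that by (auto simp: commutant_def unit_set_def)
    have "x * e i j = e i j * x" if "i < n" "j < n" for i j
      unfolding e_eq using that by (simp add: distrib_left distrib_right x)
    moreover have "x * f a b = f a b * x" if "a < 2" "b < 2" for a b
      unfolding f_eq[OF that] sum_distrib_left sum_distrib_right
      using that by (intro sum.cong refl x) auto
    ultimately show "x \<in> commutant (unit_set n e) \<inter> commutant (unit_set 2 f)"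
      by (auto simp: commutant_def unit_set_def)
  next
    fix x assume *: "x \<in> commutant (unit_set n e) \<inter> commutant (unit_set 2 f)"
    have x: "x * e i j = e i j * x" if "i < n" "j < n" for i j
    proof -
      have "e i j \<in> unit_set n e" using that by (auto simp: unit_set_def)
      then show ?thesis using * by (simp add: commutant_def)
    qed
    have x': "x * f i j = f i j * x" if "i < 2" "j < 2" for i j
    proof -
      have "f i j \<in> unit_set 2 f" using that by (auto simp: unit_set_def)
      then show ?thesis using * by (simp add: commutant_def)
    qed
    have mult: "x * (y * y') = y * y' * x" if "x * y = y * x" "x * y' = y' * x" for y y'
      using that by (metis mult.assoc)
    have "x * g i j = g i j * x" if "i < 2 * n" "j < 2 * n" for i j
      unfolding g_def using that by (intro mult x x') auto
    then show "x \<in> commutant (unit_set (2 * n) g)"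
      by (auto simp: commutant_def unit_set_def)
  qed
qed

text \<open>For an involution \<open>A\<close> anticommuting with \<open>B\<close>, \<open>P\<close>
  and \<open>Q\<close> are the projections onto the eigenspaces of \<open>A\<close>, and
  \<open>B\<close> interchanges these. With \<open>B * B = c *\<^sub>R 1\<close> and
  \<open>c * c = 1\<close>, the factor \<open>c\<close> in the lower left corner makes the
  off-diagonal units multiply to \<open>P\<close> and \<open>Q\<close>.\<close>

definition pair_units :: "'a::real_algebra_1 \<Rightarrow> 'a \<Rightarrow> real \<Rightarrow> nat \<Rightarrow> nat \<Rightarrow> 'a" where
  "pair_units A B c i j =
     (let P = (1/2) *\<^sub>R (1 + A); Q = (1/2) *\<^sub>R (1 - A)
      in if i = 0 then if j = 0 then P else P * B else if j = 0 then c *\<^sub>R (Q * B) else Q)"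

lemma pair_units:
  fixes A B :: "'a::real_algebra_1"
  assumes A: "A * A = 1" and B: "B * B = c *\<^sub>R 1" and c: "c * c = 1" and AB: "B * A = - (A * B)"
  shows "matrix_units 2 (pair_units A B c)"
    and "commutant (unit_set 2 (pair_units A B c)) = commutant {A, B}"
    and "A \<in> commutant S \<Longrightarrow> B \<in> commutant S \<Longrightarrow> unit_set 2 (pair_units A B c) \<subseteq> commutant S"
proof -
  define P Q where "P = (1/2) *\<^sub>R (1 + A)" and "Q = (1/2) *\<^sub>R (1 - A)"
  have f: "pair_units A B c i j =
      (if i = 0 then if j = 0 then P else P * B else if j = 0 then c *\<^sub>R (Q * B) else Q)" for i j
    by (simp add: pair_units_def P_def Q_def)
  have PQ: "P * P = P" "Q * Q = Q" "P * Q = 0" "Q * P = 0" "P + Q = 1" "B * P = Q * B" "B * Q = P * B"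
    unfolding P_def Q_def using A AB
    by (simp_all add: algebra_simps flip: scaleR_add_left)
  have PQ': "P * (P * x) = P * x" "Q * (Q * x) = Q * x" "P * (Q * x) = 0" "Q * (P * x) = 0"
      "B * (P * x) = Q * (B * x)" "B * (Q * x) = P * (B * x)" "B * (B * x) = c *\<^sub>R x" for x
    using PQ B by (simp_all flip: mult.assoc)
  show "matrix_units 2 (pair_units A B c)"
    unfolding matrix_units_def all_less_2 f
    by (simp add: mult.assoc PQ PQ' B c numeral_2_eq_2)
  have unit_set: "unit_set 2 (pair_units A B c) = {P, P * B, c *\<^sub>R (Q * B), Q}"
    unfolding unit_set_def f by (auto simp: less_2_cases_iff)
  \<comment> \<open>Conversely \<open>A\<close> and \<open>B\<close> are combinations of the four
    units, for \<open>B\<close> because \<open>c * c = 1\<close>, so the units and the pair have the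
    same commutant.\<close>
  have A_eq: "A = P - Q" and B_eq: "B = P * B + c *\<^sub>R (c *\<^sub>R (Q * B))"
    unfolding scaleR_scaleR c P_def Q_def by (simp_all add: algebra_simps flip: scaleR_add_left)
  show "commutant (unit_set 2 (pair_units A B c)) = commutant {A, B}"
  proof (intro equalityI subsetI)
    fix x assume "x \<in> commutant (unit_set 2 (pair_units A B c))"
    then have x: "x * P = P * x" "x * (P * B) = P * B * x" "x * Q = Q * x"
        "x * (c *\<^sub>R (Q * B)) = c *\<^sub>R (Q * B) * x"
      unfolding unit_set commutant_def by blast+
    have "x * A = A * x"
      unfolding A_eq by (simp add: x algebra_simps)
    moreover have "x * (P * B + c *\<^sub>R (c *\<^sub>R (Q * B))) = (P * B + c *\<^sub>R (c *\<^sub>R (Q * B))) * x"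
      unfolding distrib_left distrib_right mult_scaleR_left[of c "c *\<^sub>R (Q * B)"]
        mult_scaleR_right[of _ c "c *\<^sub>R (Q * B)"] x ..
    ultimately show "x \<in> commutant {A, B}"
      using B_eq by (simp add: commutant_def)
  next
    fix x assume "x \<in> commutant {A, B}"
    then have x: "x * A = A * x" "x * B = B * x"
      by (auto simp: commutant_def)
    then have "x * P = P * x" "x * Q = Q * x"
      by (simp_all add: P_def Q_def algebra_simps)
    moreover from this x have "x * (P * B) = P * B * x" "x * (Q * B) = Q * B * x"
      by (metis mult.assoc)+
    ultimately show "x \<in> commutant (unit_set 2 (pair_units A B c))"
      unfolding unit_set by (simp add: commutant_def)
  qed
  show "unit_set 2 (pair_units A B c) \<subseteq> commutant S" if "A \<in> commutant S" "B \<in> commutant S"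
    unfolding unit_set P_def Q_def using that
    by (auto intro!: commutant_mult commutant_one subspace_scale subspace_add subspace_diff
      subspace_commutant)
qed

section \<open>The division algebras\<close>

lemma algebra_hom_real: "algebra_hom_on UNIV (\<lambda>r. r *\<^sub>R 1)"
  by (simp add: algebra_hom_on_def algebra_simps)

lemma algebra_hom_complex:
  assumes "Z * Z = - 1"
  shows "algebra_hom_on UNIV (\<lambda>w. Re w *\<^sub>R 1 + Im w *\<^sub>R Z)"
  by (simp add: algebra_hom_on_def algebra_simps assms)

definition quat_hom :: "'a::real_algebra_1 \<Rightarrow> 'a \<Rightarrow> quat \<Rightarrow> 'a" where
  "quat_hom A B q = qRe q *\<^sub>R 1 + qI q *\<^sub>R A + qJ q *\<^sub>R B + qK q *\<^sub>R (A * B)"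

lemma algebra_hom_quat:
  assumes A: "A * A = - 1" and B: "B * B = - 1" and AB: "B * A = - (A * B)"
  shows "algebra_hom_on UNIV (quat_hom A B)"
proof -
  \<comment> \<open>Together with the assumptions these rules bring every word in \<open>A\<close>
    and \<open>B\<close> to one of \<open>1\<close>, \<open>A\<close>, \<open>B\<close>,
    \<open>A * B\<close> up to sign, so the product formula for quaternions can be checked on
    coordinates.\<close>
  have "A * (A * x) = - x" "B * (B * x) = - x" "B * (A * x) = - (A * (B * x))" for x
    using A B AB by (simp_all flip: mult.assoc)
  then show ?thesis
    using A B AB
    by (simp add: algebra_hom_on_def quat_hom_def algebra_simps plus_quat_def times_quat_def
        scaleR_quat_def one_quat_def)
qed

lemma quat_left_inverse:
  fixes p :: quat
  assumes "p \<noteq> 0"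
  shows "\<exists>q. q * p = 1"
proof -
  define s where "s = (qRe p)\<^sup>2 + (qI p)\<^sup>2 + (qJ p)\<^sup>2 + (qK p)\<^sup>2"
  have "s \<noteq> 0"
    using assms by (cases p) (auto simp: s_def zero_quat_def add_nonneg_eq_0_iff)
  \<comment> \<open>The conjugate divided by the squared norm.\<close>
  then have "Quat (qRe p / s) (- qI p / s) (- qJ p / s) (- qK p / s) * p = 1"
    by (simp add: times_quat_def one_quat_def add_divide_distrib[symmetric]
        diff_divide_distrib[symmetric]) (simp add: s_def power2_eq_square mult.commute)
  then show ?thesis ..
qed

section \<open>Gradings by elementary 2-groups\<close>

text \<open>The grading is reduced to a basis indexed by \<open>T\<close> whose products are
  determined up to a real factor. That these factors are signs is a consequence, not an
  axiom.\<close>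

locale elementary_2_grading = comm_group T for T (structure) +
  fixes X :: "'a \<Rightarrow> 'b::real_algebra_1" and \<mu> :: "'a \<Rightarrow> real"
  assumes finite_T: "finite (carrier T)"
    and self_inverse: "t \<in> carrier T \<Longrightarrow> t \<otimes> t = \<one>"
    and mu_sign: "t \<in> carrier T \<Longrightarrow> \<mu> t \<in> {1, -1}"
    and X_square: "t \<in> carrier T \<Longrightarrow> X t * X t = \<mu> t *\<^sub>R 1"
    and X_mult_ex: "s \<in> carrier T \<Longrightarrow> t \<in> carrier T \<Longrightarrow> \<exists>c. X s * X t = c *\<^sub>R X (s \<otimes> t)"
    and X_independent: "(\<Sum>t\<in>carrier T. c t *\<^sub>R X t) = 0 \<Longrightarrow> t \<in> carrier T \<Longrightarrow> c t = 0"
    and X_spans: "\<exists>c. x = (\<Sum>t\<in>carrier T. c t *\<^sub>R X t)"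
begin

section \<open>Signs of products and the commutation form\<close>

definition \<beta> :: "'a \<Rightarrow> 'a \<Rightarrow> real" where
  "\<beta> s t = \<mu> (s \<otimes> t) * \<mu> s * \<mu> t"

lemma X_mult_left: "t \<in> carrier T \<Longrightarrow> X t * (X t * x) = \<mu> t *\<^sub>R x"
  by (simp add: X_square flip: mult.assoc)

lemma X_cancel:
  assumes "t \<in> carrier T" "X t * x = X t * y"
  shows "x = y"
proof -
  have "\<mu> t *\<^sub>R x = \<mu> t *\<^sub>R y"
    using assms X_mult_left by metis
  then show ?thesis
    using mu_sign[OF assms(1)] by auto
qed

lemma X_nonzero: "t \<in> carrier T \<Longrightarrow> X t \<noteq> 0"
  using X_cancel[of t 1 0] by auto

lemma X_mult_nonzero: "s \<in> carrier T \<Longrightarrow> t \<in> carrier T \<Longrightarrow> X s * X t \<noteq> 0"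
  using X_cancel[of s "X t" 0] X_nonzero by auto

text \<open>Let \<open>\<kappa>\<close> be the factor in
  \<open>X t * X s = \<kappa> *\<^sub>R (X s * X t)\<close>. Moving \<open>X s\<close> through
  \<open>X t\<close> twice gives \<open>\<kappa> * \<kappa> = 1\<close>; squaring
  \<open>X s * X t = c *\<^sub>R X (s \<otimes> t)\<close> in two ways gives
  \<open>c * c * \<mu> (s \<otimes> t) = \<kappa> * \<mu> s * \<mu> t\<close>. So
  \<open>c * c\<close> is a sign, hence 1, and then \<open>\<kappa>\<close> is
  \<open>\<beta> s t\<close>.\<close>

lemma X_products:
  assumes s: "s \<in> carrier T" and t: "t \<in> carrier T"
  shows X_mult_cases: "X s * X t = X (s \<otimes> t) \<or> X s * X t = - X (s \<otimes> t)"
    and X_commute: "X t * X s = \<beta> s t *\<^sub>R (X s * X t)"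
proof -
  obtain c d where c: "X s * X t = c *\<^sub>R X (s \<otimes> t)" and d: "X t * X s = d *\<^sub>R X (s \<otimes> t)"
    using X_mult_ex[OF s t] X_mult_ex[OF t s] m_comm[OF s t] by auto
  have "c \<noteq> 0"
    using c X_mult_nonzero[OF s t] by auto
  define \<kappa> where "\<kappa> = d / c"
  have \<kappa>: "X t * X s = \<kappa> *\<^sub>R (X s * X t)"
    using \<open>c \<noteq> 0\<close> by (simp add: c d \<kappa>_def)
  have "\<mu> s *\<^sub>R X t = (X t * X s) * X s"
    using s by (simp add: mult.assoc X_square)
  also have "\<dots> = \<kappa> *\<^sub>R (X s * (X t * X s))"
    by (simp add: \<kappa> mult.assoc)
  also have "\<dots> = (\<kappa> * \<kappa> * \<mu> s) *\<^sub>R X t"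
    using s by (simp add: \<kappa> X_mult_left)
  finally have "\<kappa> * \<kappa> = 1"
    using X_nonzero[OF t] mu_sign[OF s] by auto
  have "(c * c * \<mu> (s \<otimes> t)) *\<^sub>R (1::'b) = (X s * X t) * (X s * X t)"
    using s t by (simp add: c X_square)
  also have "\<dots> = X s * (X t * X s) * X t"
    by (simp add: mult.assoc)
  also have "\<dots> = (\<kappa> * \<mu> s * \<mu> t) *\<^sub>R 1"
    using s t by (simp add: \<kappa> mult.assoc X_mult_left X_square)
  finally have cc: "c * c * \<mu> (s \<otimes> t) = \<kappa> * \<mu> s * \<mu> t"
    by simp
  have signs: "\<mu> s \<in> {1, -1}" "\<mu> t \<in> {1, -1}" "\<mu> (s \<otimes> t) \<in> {1, -1}" "\<kappa> \<in> {1, -1}"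
    using s t mu_sign \<open>\<kappa> * \<kappa> = 1\<close> by (auto simp: square_eq_1_iff)
  then have "c * c \<in> {1, -1}"
    using cc by auto
  moreover have "c * c \<ge> 0" by simp
  ultimately have "c * c = 1" by auto
  then have "c = 1 \<or> c = -1"
    by (simp add: square_eq_1_iff)
  then show "X s * X t = X (s \<otimes> t) \<or> X s * X t = - X (s \<otimes> t)"
    using c by auto
  have "\<kappa> = \<beta> s t"
    using cc signs unfolding \<beta>_def \<open>c * c = 1\<close> by auto
  then show "X t * X s = \<beta> s t *\<^sub>R (X s * X t)"
    using \<kappa> by simp
qed

lemma beta_sign: "s \<in> carrier T \<Longrightarrow> t \<in> carrier T \<Longrightarrow> \<beta> s t \<in> {1, -1}"
  using mu_sign[of s] mu_sign[of t] mu_sign[of "s \<otimes> t"] by (auto simp: \<beta>_def)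

lemma beta_sym: "s \<in> carrier T \<Longrightarrow> t \<in> carrier T \<Longrightarrow> \<beta> s t = \<beta> t s"
  by (simp add: \<beta>_def m_comm)

lemma beta_self:
  assumes "t \<in> carrier T"
  shows "\<beta> t t = 1"
  using X_commute[OF assms assms] X_mult_nonzero[OF assms assms]
  by (metis scaleR_cancel_right scaleR_one)

text \<open>By its definition \<open>\<beta> \<one> \<one>\<close> is the cube of
  \<open>\<mu> \<one>\<close>.\<close>

lemma mu_one: "\<mu> \<one> = 1"
  using beta_self[of \<one>] mu_sign[of \<one>] by (auto simp: \<beta>_def)

text \<open>The sign is a free choice: \<open>X \<one>\<close> may be -1, which is why both signs
  reappear in the terminal stages.\<close>

lemma X_one: "X \<one> = 1 \<or> X \<one> = -1"
proof -
  have "X \<one> * X \<one> = X \<one> * 1 \<or> X \<one> * X \<one> = X \<one> * (-1)"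
    using X_mult_cases[of \<one> \<one>] by simp
  then show ?thesis
    using X_cancel[of \<one>] by blast
qed

lemma mu_mult: "s \<in> carrier T \<Longrightarrow> t \<in> carrier T \<Longrightarrow> \<mu> (s \<otimes> t) = \<beta> s t * \<mu> s * \<mu> t"
  using mu_sign[of s] mu_sign[of t] by (auto simp: \<beta>_def)

text \<open>Associativity is the source of bilinearity: \<open>X u\<close> passes
  \<open>X s * X t\<close> either factor by factor or, up to a sign, as the single element
  \<open>X (s \<otimes> t)\<close>.\<close>

lemma beta_mult_left:
  assumes s: "s \<in> carrier T" and t: "t \<in> carrier T" and u: "u \<in> carrier T"
  shows "\<beta> (s \<otimes> t) u = \<beta> s u * \<beta> t u"
proof -
  have st: "s \<otimes> t \<in> carrier T" using s t by simp
  have "X u * (X s * X t) = (X u * X s) * X t"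
    by (simp add: mult.assoc)
  also have "\<dots> = \<beta> s u *\<^sub>R (X s * (X u * X t))"
    by (simp add: X_commute[OF s u] mult.assoc)
  also have "\<dots> = (\<beta> s u * \<beta> t u) *\<^sub>R (X s * X t * X u)"
    by (simp add: X_commute[OF t u] mult.assoc)
  finally have 1: "X u * (X s * X t) = (\<beta> s u * \<beta> t u) *\<^sub>R (X s * X t * X u)" .
  have "X u * (X s * X t) = \<beta> (s \<otimes> t) u *\<^sub>R (X s * X t * X u)"
    using X_mult_cases[OF s t] X_commute[OF st u] by auto
  moreover have "X s * X t * X u \<noteq> 0"
    using X_mult_cases[OF s t] X_mult_nonzero[OF st u] by auto
  ultimately show ?thesis
    using 1 by simp
qed

lemma beta_mult_right:
  "s \<in> carrier T \<Longrightarrow> t \<in> carrier T \<Longrightarrow> u \<in> carrier T \<Longrightarrow> \<beta> u (s \<otimes> t) = \<beta> u s * \<beta> u t"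
  using beta_mult_left[of s t u] by (simp add: beta_sym[of u])

lemma quadratic_form_mu: "quadratic_form T \<mu>"
proof -
  have "\<mu> (u \<otimes> v) * inverse (\<mu> u) * inverse (\<mu> v) = \<beta> u v" if "u \<in> carrier T" "v \<in> carrier T" for u v
    using mu_sign[OF that(1)] mu_sign[OF that(2)] by (auto simp: \<beta>_def)
  moreover have "\<beta> u v \<noteq> 0" if "u \<in> carrier T" "v \<in> carrier T" for u v
    using beta_sign[OF that] by auto
  ultimately show ?thesis
    unfolding quadratic_form_def alternating_bicharacter_def
    using mu_sign by (simp add: beta_mult_left beta_mult_right beta_self)
qed

lemma commute_iff: "s \<in> carrier T \<Longrightarrow> t \<in> carrier T \<Longrightarrow> X s * X t = X t * X s \<longleftrightarrow> \<beta> s t = 1"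
  using X_commute[of s t] X_mult_nonzero[of s t] by (metis scaleR_cancel_right scaleR_one)

section \<open>Spans of basis elements, their commutants and the center\<close>

lemma X_not_proportional:
  assumes "s \<in> carrier T" "t \<in> carrier T" "s \<noteq> t"
  shows "X s \<noteq> c *\<^sub>R X t"
proof
  assume eq: "X s = c *\<^sub>R X t"
  let ?d = "\<lambda>u. (if u = s then 1 else 0) - (if u = t then c else 0)"
  have "(\<Sum>u\<in>carrier T. ?d u *\<^sub>R X u) =
      (\<Sum>u\<in>carrier T. (if u = s then X s else 0) - (if u = t then c *\<^sub>R X t else 0))"
    by (intro sum.cong) (auto simp: algebra_simps)
  also have "\<dots> = X s - c *\<^sub>R X t"
    using assms finite_T by (simp add: sum_subtractf)
  finally have "?d s = 0"
    using eq X_independent[of ?d s] assms by auto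
  then show False
    using assms by simp
qed

lemma span_X:
  assumes "U \<subseteq> carrier T"
  shows "x \<in> span (X ` U) \<longleftrightarrow> (\<exists>c. x = (\<Sum>t\<in>U. c t *\<^sub>R X t))"
proof
  have fin: "finite U"
    using assms finite_T finite_subset by blast
  let ?V = "{x. \<exists>c. x = (\<Sum>t\<in>U. c t *\<^sub>R X t)}"
  have "subspace ?V"
    unfolding subspace_def
  proof (intro conjI ballI allI)
    show "0 \<in> ?V"
      by (auto intro!: exI[of _ "\<lambda>_. 0"])
  next
    fix x y assume "x \<in> ?V" "y \<in> ?V"
    then obtain c d where "x = (\<Sum>t\<in>U. c t *\<^sub>R X t)" "y = (\<Sum>t\<in>U. d t *\<^sub>R X t)" by auto
    then have "x + y = (\<Sum>t\<in>U. (c t + d t) *\<^sub>R X t)"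
      by (simp add: scaleR_add_left sum.distrib)
    then show "x + y \<in> ?V"
      by (auto intro!: exI[of _ "\<lambda>t. c t + d t"])
  next
    fix r x assume "x \<in> ?V"
    then obtain c where "x = (\<Sum>t\<in>U. c t *\<^sub>R X t)" by auto
    then have "r *\<^sub>R x = (\<Sum>t\<in>U. (r * c t) *\<^sub>R X t)"
      by (simp add: scaleR_sum_right)
    then show "r *\<^sub>R x \<in> ?V"
      by (auto intro!: exI[of _ "\<lambda>t. r * c t"])
  qed
  moreover have "X ` U \<subseteq> ?V"
  proof clarify
    fix u assume "u \<in> U"
    then have "X u = (\<Sum>t\<in>U. if t = u then X u else 0)"
      using fin by simp
    also have "\<dots> = (\<Sum>t\<in>U. (if t = u then 1 else 0) *\<^sub>R X t)"
      by (intro sum.cong) auto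
    finally show "\<exists>c. X u = (\<Sum>t\<in>U. c t *\<^sub>R X t)"
      by (intro exI[of _ "\<lambda>t. if t = u then 1 else 0"])
  qed
  ultimately show "x \<in> span (X ` U) \<Longrightarrow> \<exists>c. x = (\<Sum>t\<in>U. c t *\<^sub>R X t)"
    using span_minimal by blast
next
  assume "\<exists>c. x = (\<Sum>t\<in>U. c t *\<^sub>R X t)"
  then obtain c where "x = (\<Sum>t\<in>U. c t *\<^sub>R X t)" ..
  then show "x \<in> span (X ` U)"
    by (simp add: span_base span_scale span_sum)
qed

lemma span_X_UNIV: "span (X ` carrier T) = UNIV"
proof -
  have "x \<in> span (X ` carrier T)" for x
    unfolding span_X[OF order_refl] by (rule X_spans)
  then show ?thesis by blast
qed

definition perp :: "'a set \<Rightarrow> 'a set \<Rightarrow> 'a set" where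
  "perp U W = {t \<in> U. \<forall>w\<in>W. \<beta> w t = 1}"

text \<open>Conjugation by \<open>X w\<close> multiplies the coefficient at \<open>t\<close> by
  \<open>\<beta> w t\<close>, so by independence an element commuting with \<open>X w\<close> has
  coefficient 0 wherever this sign is -1.\<close>

lemma span_Int_commutant:
  assumes U: "U \<subseteq> carrier T" and W: "W \<subseteq> carrier T"
  shows "span (X ` U) \<inter> commutant (X ` W) = span (X ` perp U W)"
proof (intro equalityI subsetI)
  fix x assume x: "x \<in> span (X ` U) \<inter> commutant (X ` W)"
  then have comm: "\<And>w. w \<in> W \<Longrightarrow> x * X w = X w * x"
    by (simp add: commutant_def)
  obtain c where c: "x = (\<Sum>t\<in>U. c t *\<^sub>R X t)"
    using x span_X[OF U, of x] by auto
  have "c t = 0" if "t \<in> U" "w \<in> W" "\<beta> w t \<noteq> 1" for t w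
  proof -
    \<comment> \<open>Extension by zero, since \<open>X_independent\<close> is about sums over the
      whole group.\<close>
    let ?d = "\<lambda>t. if t \<in> U then c t * (1 - \<beta> w t) else 0"
    have "X w * (\<Sum>t\<in>U. (c t * \<beta> w t) *\<^sub>R X t) = (\<Sum>t\<in>U. c t *\<^sub>R (X t * X w))"
      unfolding sum_distrib_left
    proof (intro sum.cong refl)
      fix s assume "s \<in> U"
      then have "X s * X w = \<beta> w s *\<^sub>R (X w * X s)"
        using U W that(2) by (intro X_commute) auto
      then show "X w * (c s * \<beta> w s) *\<^sub>R X s = c s *\<^sub>R (X s * X w)"
        by simp
    qed
    also have "\<dots> = x * X w"
      by (simp add: c sum_distrib_right)
    also have "\<dots> = X w * x"
      by (rule comm[OF that(2)])
    finally have "(\<Sum>t\<in>U. (c t * \<beta> w t) *\<^sub>R X t) = x"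
      by (rule X_cancel[rotated]) (use W that(2) in auto)
    then have "(\<Sum>t\<in>U. (c t * (1 - \<beta> w t)) *\<^sub>R X t) = 0"
      by (simp add: c right_diff_distrib scaleR_diff_left sum_subtractf)
    moreover have "(\<Sum>t\<in>carrier T. ?d t *\<^sub>R X t) = (\<Sum>t\<in>U. (c t * (1 - \<beta> w t)) *\<^sub>R X t)"
      using U finite_T by (intro sum.mono_neutral_cong_right) auto
    ultimately have "?d t = 0"
      using X_independent[of ?d t] U that by auto
    then show ?thesis
      using that by simp
  qed
  then have "x = (\<Sum>t\<in>perp U W. c t *\<^sub>R X t)"
    unfolding c using finite_subset[OF U finite_T]
    by (intro sum.mono_neutral_right) (auto simp: perp_def)
  moreover have "perp U W \<subseteq> carrier T"
    using U by (auto simp: perp_def)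
  ultimately show "x \<in> span (X ` perp U W)"
    using span_X by blast
next
  have "span (X ` perp U W) \<subseteq> span (X ` U)"
    by (intro span_mono) (auto simp: perp_def)
  moreover have "X ` perp U W \<subseteq> commutant (X ` W)"
  proof (clarsimp simp: commutant_def)
    fix t w assume "t \<in> perp U W" "w \<in> W"
    then have "w \<in> carrier T" "t \<in> carrier T" "\<beta> w t = 1"
      using U W by (auto simp: perp_def)
    then show "X t * X w = X w * X t"
      by (simp add: commute_iff[symmetric])
  qed
  then have "span (X ` perp U W) \<subseteq> commutant (X ` W)"
    by (intro span_minimal subspace_commutant)
  ultimately show "x \<in> span (X ` U) \<inter> commutant (X ` W)" if "x \<in> span (X ` perp U W)" for x
    using that by blast
qed

definition radical :: "'a set \<Rightarrow> 'a set" where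
  "radical U = perp U U"

text \<open>Being central is the same as commuting with the spanning set of all \<open>X t\<close>,
  so \<open>span_Int_commutant\<close> applies with the whole group in both places.\<close>

lemma algebra_center_eq: "algebra_center = span (X ` radical (carrier T))"
proof -
  have "algebra_center = (commutant (X ` carrier T) :: 'b set)"
  proof (intro equalityI subsetI)
    fix z :: 'b assume z: "z \<in> commutant (X ` carrier T)"
    have "z * x = x * z" for x
    proof -
      obtain c where "x = (\<Sum>t\<in>carrier T. c t *\<^sub>R X t)"
        using X_spans by blast
      moreover have "z * X t = X t * z" if "t \<in> carrier T" for t
        using z that by (simp add: commutant_def)
      ultimately show ?thesis
        by (simp add: sum_distrib_left sum_distrib_right cong: sum.cong)
    qed
    then show "z \<in> algebra_center"
      by (simp add: algebra_center_def)
  qed (auto simp: algebra_center_def commutant_def)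
  then show ?thesis
    using span_Int_commutant[of "carrier T" "carrier T"] by (simp add: span_X_UNIV radical_def)
qed

lemma dim_algebra_center: "dim (algebra_center :: 'b set) = card (radical (carrier T))"
proof -
  let ?R = "radical (carrier T)"
  have R: "?R \<subseteq> carrier T" by (auto simp: radical_def perp_def)
  have inj: "inj_on X (carrier T)"
  proof (rule inj_onI, rule ccontr)
    fix s t assume "s \<in> carrier T" "t \<in> carrier T" "X s = X t" "s \<noteq> t"
    then show False
      using X_not_proportional[of s t 1] by simp
  qed
  have "independent (X ` carrier T)"
  proof (rule independent_if_scalars_zero)
    fix f x assume sum: "(\<Sum>y\<in>X ` carrier T. f y *\<^sub>R y) = 0" and "x \<in> X ` carrier T"
    then obtain t where t: "t \<in> carrier T" "x = X t" by blast
    have "(\<Sum>t\<in>carrier T. f (X t) *\<^sub>R X t) = 0"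
      using sum by (simp add: sum.reindex[OF inj])
    then show "f x = 0"
      using X_independent[of "\<lambda>t. f (X t)" t] t by simp
  qed (simp add: finite_T)
  then have "independent (X ` ?R)"
    by (rule independent_mono) (rule image_mono[OF R])
  then have "dim (span (X ` ?R)) = card (X ` ?R)"
    by (intro dim_eq_card) (simp_all add: span_span)
  also have "\<dots> = card ?R"
    by (rule card_image) (rule inj_on_subset[OF inj R])
  finally show ?thesis
    by (simp add: algebra_center_eq)
qed

section \<open>Orthogonal complements and the splitting of an anticommuting pair\<close>

lemma perp_subset: "perp U W \<subseteq> U"
  by (auto simp: perp_def)

lemma mult_mult_self:
  assumes "a \<in> carrier T" "t \<in> carrier T"
  shows "a \<otimes> (a \<otimes> t) = t"
proof -
  have "a \<otimes> (a \<otimes> t) = a \<otimes> a \<otimes> t"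
    using assms by (simp add: m_assoc)
  then show ?thesis
    using assms by (simp add: self_inverse)
qed

text \<open>The sign \<open>\<beta> w t\<close> flips under translation by \<open>a\<close>, so the
  \<open>t\<close> with sign 1 and their translates halve \<open>S\<close>. This is applied twice
  below, with \<open>a\<close> and \<open>b\<close> exchanging roles.\<close>

lemma perp_translates:
  fixes f :: "'a \<Rightarrow> real"
  assumes S: "S \<subseteq> carrier T" and a: "a \<in> carrier T" "\<And>t. t \<in> S \<Longrightarrow> a \<otimes> t \<in> S"
    and w: "w \<in> carrier T" "\<beta> w a = -1"
  shows perp_translates_Un: "S = perp S {w} \<union> (\<lambda>t. a \<otimes> t) ` perp S {w}"
    and sum_perp_translates: "sum f S = (\<Sum>t\<in>perp S {w}. f t + f (a \<otimes> t))"
proof -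
  have beta: "\<beta> w (a \<otimes> t) = - \<beta> w t" "a \<otimes> (a \<otimes> t) = t" "\<beta> w t \<in> {1, -1}" if "t \<in> S" for t
    using S a w that beta_sign mult_mult_self by (auto simp: beta_mult_right)
  have Sa: "t \<in> (\<lambda>t. a \<otimes> t) ` perp S {w}" if "t \<in> S" "\<beta> w t \<noteq> 1" for t
    using that beta[OF that(1)] a(2) by (intro image_eqI[of _ _ "a \<otimes> t"]) (auto simp: perp_def)
  then show Un: "S = perp S {w} \<union> (\<lambda>t. a \<otimes> t) ` perp S {w}"
    using a(2) by (auto simp: perp_def)
  have "perp S {w} \<inter> (\<lambda>t. a \<otimes> t) ` perp S {w} = {}"
    using beta by (auto simp: perp_def)
  moreover have "finite (perp S {w})"
    using S finite_T perp_subset by (meson finite_subset)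
  ultimately have "sum f S = sum f (perp S {w}) + sum f ((\<lambda>t. a \<otimes> t) ` perp S {w})"
    by (subst Un) (simp add: sum.union_disjoint)
  also have "inj_on (\<lambda>t. a \<otimes> t) (perp S {w})"
    using beta perp_subset by (intro inj_onI) (metis subsetD)
  then have "sum f ((\<lambda>t. a \<otimes> t) ` perp S {w}) = (\<Sum>t\<in>perp S {w}. f (a \<otimes> t))"
    by (simp add: sum.reindex)
  finally show "sum f S = (\<Sum>t\<in>perp S {w}. f t + f (a \<otimes> t))"
    by (simp add: sum.distrib)
qed

lemma subgroup_perp:
  assumes "subgroup U T" "W \<subseteq> carrier T"
  shows "subgroup (perp U W) T"
proof -
  have U: "U \<subseteq> carrier T"
    using assms(1) by (rule subgroup.subset)
  have "inv t = t" if "t \<in> carrier T" for t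
    using self_inverse[OF that] that by (simp add: inv_equality)
  moreover have "\<beta> w \<one> = 1" if "w \<in> W" for w
    using beta_mult_right[of \<one> \<one> w] beta_sign[of w \<one>] subsetD[OF assms(2) that] by auto
  moreover have "\<beta> w (s \<otimes> t) = 1" if "w \<in> W" "s \<in> perp U W" "t \<in> perp U W" for w s t
    using that assms(2) U by (auto simp: perp_def beta_mult_right subset_iff)
  ultimately show ?thesis
    using assms(1) U
    by (intro subgroup.intro)
      (auto simp: perp_def subset_iff subgroup.m_closed subgroup.one_closed)
qed

context
  fixes U a b
  assumes U: "subgroup U T" and a: "a \<in> U" and b: "b \<in> U" and ab: "\<beta> a b = -1"
begin

private lemma carrier: "U \<subseteq> carrier T" "a \<in> carrier T" "b \<in> carrier T"
  using subgroup.subset[OF U] a b by auto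

private lemma ba: "\<beta> b a = -1"
  using ab beta_sym carrier by simp

private lemma perp_perp: "perp (perp U {b}) {a} = perp U {a, b}"
  by (auto simp: perp_def)

text \<open>The second closure rests on \<open>\<beta> b b = 1\<close>: translating by
  \<open>b\<close> does not leave the complement of \<open>b\<close>.\<close>

private lemma translate_closed: "t \<in> U \<Longrightarrow> a \<otimes> t \<in> U" "t \<in> perp U {b} \<Longrightarrow> b \<otimes> t \<in> perp U {b}"
  using carrier a b subgroup.m_closed[OF U]
  by (auto simp: perp_def beta_mult_right beta_self subset_iff)

private lemma perp_carrier: "perp U W \<subseteq> carrier T"
  using perp_subset carrier by blast

text \<open>Halving along \<open>b\<close> by translates of \<open>a\<close>, and then along
  \<open>a\<close> by translates of \<open>b\<close>, cuts \<open>U\<close> into the four cosets of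
  the complement of the pair.\<close>

private lemma hyperbolic_cases:
  assumes "t \<in> U"
  obtains s where "s \<in> perp U {a, b}" "t \<in> {s, b \<otimes> s, a \<otimes> s, a \<otimes> (b \<otimes> s)}"
proof -
  have 1: "U = perp U {b} \<union> (\<lambda>t. a \<otimes> t) ` perp U {b}"
    using carrier translate_closed ba by (intro perp_translates_Un) auto
  have 2: "perp U {b} = perp (perp U {b}) {a} \<union> (\<lambda>t. b \<otimes> t) ` perp (perp U {b}) {a}"
    using carrier translate_closed ab perp_carrier by (intro perp_translates_Un) auto
  from assms 1 obtain r where "r \<in> perp U {b}" "t \<in> {r, a \<otimes> r}"
    by blast
  moreover from this 2 obtain s where "s \<in> perp U {a, b}" "r \<in> {s, b \<otimes> s}"
    unfolding perp_perp by blast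
  ultimately show ?thesis
    using that by blast
qed

lemma sum_hyperbolic_split:
  fixes f :: "'a \<Rightarrow> real"
  shows "sum f U = (\<Sum>t\<in>perp U {a, b}. f t + f (a \<otimes> t) + (f (b \<otimes> t) + f (a \<otimes> (b \<otimes> t))))"
proof -
  have "sum f U = (\<Sum>t\<in>perp U {b}. f t + f (a \<otimes> t))"
    using carrier translate_closed ba by (intro sum_perp_translates) auto
  also have "\<dots> = (\<Sum>t\<in>perp (perp U {b}) {a}.
      f t + f (a \<otimes> t) + (f (b \<otimes> t) + f (a \<otimes> (b \<otimes> t))))"
    using carrier translate_closed ab perp_carrier by (intro sum_perp_translates) auto
  finally show ?thesis
    by (simp add: perp_perp)
qed

lemma card_hyperbolic_split: "card U = 4 * card (perp U {a, b})"
proof -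
  have "real (card U) = real (4 * card (perp U {a, b}))"
    using sum_hyperbolic_split[of "\<lambda>_. 1"] by simp
  then show ?thesis
    by (simp only: of_nat_eq_iff)
qed

text \<open>On each set \<open>t\<close>, \<open>a \<otimes> t\<close>,
  \<open>b \<otimes> t\<close>, \<open>a \<otimes> (b \<otimes> t)\<close> the four values of
  \<open>\<mu>\<close> are the four terms of the factor times \<open>\<mu> t\<close>; the minus sign
  is \<open>\<beta> a b\<close>.\<close>

lemma sum_mu_hyperbolic_split:
  "sum \<mu> U = (1 + \<mu> a + \<mu> b - \<mu> a * \<mu> b) * sum \<mu> (perp U {a, b})"
proof -
  have "\<mu> t + \<mu> (a \<otimes> t) + (\<mu> (b \<otimes> t) + \<mu> (a \<otimes> (b \<otimes> t))) =
      (1 + \<mu> a + \<mu> b - \<mu> a * \<mu> b) * \<mu> t" if "t \<in> perp U {a, b}" for t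
  proof -
    have t: "t \<in> carrier T" "\<beta> a t = 1" "\<beta> b t = 1"
      using that carrier by (auto simp: perp_def)
    have "\<mu> (a \<otimes> (b \<otimes> t)) = \<beta> a (b \<otimes> t) * \<mu> a * \<mu> (b \<otimes> t)"
      using t carrier by (intro mu_mult) auto
    also have "\<beta> a (b \<otimes> t) = -1"
      using t carrier ab by (simp add: beta_mult_right)
    finally show ?thesis
      using t carrier by (simp add: mu_mult[of a t] mu_mult[of b t] algebra_simps)
  qed
  then show ?thesis
    by (simp add: sum_hyperbolic_split[of \<mu>] sum_distrib_left)
qed

text \<open>An induction principle for spans, which reduces the quaternion stages to the complement
  of the pair; the sign in \<open>X (s \<otimes> t) = \<plusminus> X s * X t\<close> is absorbed by
  the subspace.\<close>

lemma span_hyperbolic_split: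
  assumes V: "subspace V" and perp: "\<And>t. t \<in> perp U {a, b} \<Longrightarrow> X t \<in> V"
    and closed: "\<And>v. v \<in> V \<Longrightarrow> X a * v \<in> V" "\<And>v. v \<in> V \<Longrightarrow> X b * v \<in> V"
  shows "span (X ` U) \<subseteq> V"
proof (intro span_minimal V, clarify)
  have mult: "X (s \<otimes> t) \<in> V" if "s \<in> {a, b}" "X t \<in> V" "t \<in> carrier T" for s t
  proof -
    have s: "s \<in> carrier T" "X s * X t \<in> V"
      using that closed carrier by auto
    have "X (s \<otimes> t) = X s * X t \<or> X (s \<otimes> t) = - (X s * X t)"
      using X_mult_cases[OF s(1) that(3)] by auto
    then show ?thesis
      using s(2) subspace_neg[OF V] by metis
  qed
  show "X t \<in> V" if "t \<in> U" for t
  proof -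
    obtain s where s: "s \<in> perp U {a, b}" "t \<in> {s, b \<otimes> s, a \<otimes> s, a \<otimes> (b \<otimes> s)}"
      using hyperbolic_cases[OF \<open>t \<in> U\<close>] .
    have "s \<in> carrier T" "X s \<in> V"
      using s(1) perp_carrier perp by auto
    then show ?thesis
      using s(2) carrier mult[of a s] mult[of b s] mult[of a "b \<otimes> s"] by auto
  qed
qed

text \<open>An element of the smaller radical is orthogonal to \<open>a\<close>, to \<open>b\<close>
  and to their complement, hence by bilinearity to all four cosets.\<close>

lemma radical_hyperbolic_split: "radical (perp U {a, b}) = radical U"
proof (intro equalityI subsetI)
  fix t assume "t \<in> radical U"
  then show "t \<in> radical (perp U {a, b})"
    using a b by (auto simp: radical_def perp_def)
next
  fix t assume "t \<in> radical (perp U {a, b})"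
  then have t: "t \<in> U" "\<beta> a t = 1" "\<beta> b t = 1" "\<And>w. w \<in> perp U {a, b} \<Longrightarrow> \<beta> w t = 1"
    by (auto simp: radical_def perp_def)
  have tc: "t \<in> carrier T" using t(1) carrier by auto
  have "\<beta> w t = 1" if "w \<in> U" for w
  proof -
    obtain s where s: "s \<in> perp U {a, b}" "w \<in> {s, b \<otimes> s, a \<otimes> s, a \<otimes> (b \<otimes> s)}"
      using hyperbolic_cases[OF \<open>w \<in> U\<close>] .
    have "s \<in> carrier T" "\<beta> s t = 1"
      using s(1) perp_carrier t(4) by auto
    then show ?thesis
      using s(2) carrier tc t(2,3) by (auto simp: beta_mult_left)
  qed
  then show "t \<in> radical U"
    using t(1) by (simp add: radical_def perp_def)
qed

end

section \<open>Repeated splitting\<close>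

text \<open>The invariant after \<open>k\<close> splittings. The first two clauses describe the
  algebra as matrices over the span of the \<open>X t\<close> with \<open>t \<in> U\<close>; the
  last three carry along the radical, the order and the sum, from which the dimension of the center,
  \<open>N\<close> and the Arf invariant are read off in the end.\<close>

definition hyperbolic_stage :: "nat \<Rightarrow> (nat \<Rightarrow> nat \<Rightarrow> 'b) \<Rightarrow> 'a set \<Rightarrow> bool" where
  "hyperbolic_stage k e U \<longleftrightarrow>
     matrix_units (2 ^ k) e \<and> commutant (unit_set (2 ^ k) e) = span (X ` U) \<and>
     subgroup U T \<and> radical U = radical (carrier T) \<and>
     card (carrier T) = 4 ^ k * card U \<and> sum \<mu> (carrier T) = 2 ^ k * sum \<mu> U"

lemma hyperbolic_stage_0: "hyperbolic_stage 0 (\<lambda>_ _. 1) (carrier T)"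
  by (auto simp: hyperbolic_stage_def matrix_units_def commutant_def unit_set_def span_X_UNIV
      subgroup_self)

text \<open>The pair lies in the current commutant, so its units commute with the old ones and the
  two systems combine. \<open>\<mu> a = 1\<close> makes \<open>X a\<close> an involution, and
  \<open>\<mu> b\<close> enters as the constant \<open>c\<close> of
  \<open>pair_units\<close>.\<close>

lemma hyperbolic_stage_Suc:
  assumes stage: "hyperbolic_stage k e U"
    and a: "a \<in> U" and b: "b \<in> U" and ab: "\<beta> a b = -1" and mu_a: "\<mu> a = 1"
  shows "\<exists>e'. hyperbolic_stage (Suc k) e' (perp U {a, b})"
proof -
  have mu: "matrix_units (2 ^ k) e" and comm: "commutant (unit_set (2 ^ k) e) = span (X ` U)"
    and U: "subgroup U T" and rest: "radical U = radical (carrier T)"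
    "card (carrier T) = 4 ^ k * card U" "sum \<mu> (carrier T) = 2 ^ k * sum \<mu> U"
    using stage by (auto simp: hyperbolic_stage_def)
  have carrier: "a \<in> carrier T" "b \<in> carrier T" "U \<subseteq> carrier T"
    using subgroup.subset[OF U] a b by auto
  let ?f = "pair_units (X a) (X b) (\<mu> b)"
  have sq: "X a * X a = 1" "X b * X b = \<mu> b *\<^sub>R 1" "\<mu> b * \<mu> b = 1" "X b * X a = - (X a * X b)"
    using X_square carrier mu_a mu_sign[of b] X_commute[of a b] ab by auto
  have "unit_set 2 ?f \<subseteq> commutant (unit_set (2 ^ k) e)"
    using a b comm by (intro pair_units(3) sq) (auto intro: span_base)
  note double = matrix_units_double[OF mu pair_units(1)[OF sq] this]
  have "commutant (unit_set (2 ^ k) e) \<inter> commutant (unit_set 2 ?f) =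
      span (X ` U) \<inter> commutant (X ` {a, b})"
    using comm pair_units(2)[OF sq] by simp
  also have "\<dots> = span (X ` perp U {a, b})"
    using carrier by (intro span_Int_commutant) auto
  finally have span: "commutant (unit_set (2 ^ k) e) \<inter> commutant (unit_set 2 ?f) =
      span (X ` perp U {a, b})" .
  have "subgroup (perp U {a, b}) T"
    using U carrier by (intro subgroup_perp) auto
  then show ?thesis
    using double[unfolded span] rest mu_a
    by (auto simp: hyperbolic_stage_def radical_hyperbolic_split[OF U a b ab]
        card_hyperbolic_split[OF U a b ab] sum_mu_hyperbolic_split[OF U a b ab])
qed

lemma hyperbolic_stage_final:
  assumes "hyperbolic_stage k e U"
  obtains k e U where "hyperbolic_stage k e U"
    "\<And>a b. a \<in> U \<Longrightarrow> b \<in> U \<Longrightarrow> \<beta> a b = -1 \<Longrightarrow> \<mu> a = -1"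
  using assms
proof (induction "card U" arbitrary: k e U thesis rule: less_induct)
  case less
  have U: "subgroup U T"
    using less.prems(2) by (simp add: hyperbolic_stage_def)
  show ?case
  proof (cases "\<exists>a\<in>U. \<exists>b\<in>U. \<beta> a b = -1 \<and> \<mu> a = 1")
    case True
    then obtain a b where ab: "a \<in> U" "b \<in> U" "\<beta> a b = -1" "\<mu> a = 1" by blast
    then obtain e' where e': "hyperbolic_stage (Suc k) e' (perp U {a, b})"
      using hyperbolic_stage_Suc[OF less.prems(2)] by auto
    \<comment> \<open>A quarter of the order is strictly smaller only because \<open>U\<close> is
      nonempty.\<close>
    have "card U > 0"
      using ab(1) finite_subset[OF subgroup.subset[OF U] finite_T] by (auto simp: card_gt_0_iff)
    then have "card (perp U {a, b}) < card U"
      using card_hyperbolic_split[OF U ab(1-3)] by simp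
    then show ?thesis
      by (rule less.hyps[OF _ _ e']) (use less.prems(1) in blast)
  next
    case False
    then show ?thesis
    proof (intro less.prems(1)[OF less.prems(2)])
      fix a b assume ab: "a \<in> U" "b \<in> U" "\<beta> a b = -1"
      then have "a \<in> carrier T"
        using subgroup.subset[OF U] by auto
      then show "\<mu> a = -1"
        using ab False mu_sign by auto
    qed
  qed
qed

end

section \<open>Terminal stages: identifying the last commutant\<close>

lemma subspace_pair_range:
  assumes "algebra_hom_on UNIV \<psi>"
  shows "subspace (range (\<lambda>(p, q). \<psi> p + \<psi> q * z))"
  unfolding subspace_def
proof (intro conjI ballI allI)
  have \<psi>: "\<psi> (p + q) = \<psi> p + \<psi> q" "\<psi> (r *\<^sub>R p) = r *\<^sub>R \<psi> p" for p q r
    using assms by (simp_all add: algebra_hom_on_def)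
  let ?V = "range (\<lambda>(p, q). \<psi> p + \<psi> q * z)"
  show "0 \<in> ?V"
    using \<psi>(2)[of 0 1] by (intro image_eqI[of _ _ "(0, 0)"]) auto
  fix x assume "x \<in> ?V"
  then obtain p q where x: "x = \<psi> p + \<psi> q * z" by auto
  show "r *\<^sub>R x \<in> ?V" for r
    by (rule image_eqI[of _ _ "(r *\<^sub>R p, r *\<^sub>R q)"]) (simp_all add: x \<psi> algebra_simps)
  fix y assume "y \<in> ?V"
  then obtain p' q' where y: "y = \<psi> p' + \<psi> q' * z" by auto
  show "x + y \<in> ?V"
    by (rule image_eqI[of _ _ "(p + p', q + q')"]) (simp_all add: x y \<psi> algebra_simps)
qed

context elementary_2_grading
begin

text \<open>A sum of signs is the difference of the two counts in the definition of
  \<open>Arf\<close>.\<close>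

lemma Arf_mu:
  "Arf (carrier T) \<mu> = (if sum \<mu> (carrier T) > 0 then 1 else if sum \<mu> (carrier T) = 0 then 0 else -1)"
proof -
  let ?P = "{t \<in> carrier T. \<mu> t = 1}" and ?M = "{t \<in> carrier T. \<mu> t = -1}"
  have "sum \<mu> (carrier T) = (\<Sum>t\<in>carrier T. (if \<mu> t = 1 then 1 else 0) - (if \<mu> t = -1 then 1 else 0))"
    using mu_sign by (intro sum.cong) auto
  also have "\<dots> = real (card ?P) - real (card ?M)"
    using finite_T by (simp add: sum_subtractf sum.If_cases Int_def)
  finally show ?thesis
    by (auto simp: Arf_def sgn_if)
qed

context
  fixes k e U
  assumes stage: "hyperbolic_stage k e U"
begin

private lemma U_carrier: "U \<subseteq> carrier T" and U: "subgroup U T"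
  using stage subgroup.subset by (auto simp: hyperbolic_stage_def)

private lemma units: "matrix_units (2 ^ k) e"
  and commutant: "commutant (unit_set (2 ^ k) e) = span (X ` U)"
  using stage by (auto simp: hyperbolic_stage_def)

private lemma span_closed: "1 \<in> span (X ` U)"
  "x \<in> span (X ` U) \<Longrightarrow> y \<in> span (X ` U) \<Longrightarrow> x * y \<in> span (X ` U)"
  unfolding commutant[symmetric] by (simp_all add: commutant_one commutant_mult)

private lemma X_U: "t \<in> U \<Longrightarrow> X t \<in> span (X ` U)"
  by (rule span_base) simp

private lemmas span_intros = span_closed X_U span_add span_scale

lemma stage_trivial:
  assumes "U = {\<one>}"
  shows "type_algebra TYPE('b) \<cong>\<^sub>a mat_algebra TYPE(real) (2 ^ k)"
proof (rule isomorphic_mat_algebra_if_hom[OF units algebra_hom_real])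
  have "span (X ` U) \<subseteq> range (\<lambda>r. r *\<^sub>R (1::'b))"
  proof (intro span_minimal subspace_algebra_hom_range algebra_hom_real)
    show "X ` U \<subseteq> range (\<lambda>r. r *\<^sub>R (1::'b))"
      using X_one assms image_eqI[of "1::'b" "\<lambda>r. r *\<^sub>R 1" 1] image_eqI[of "-1::'b" "\<lambda>r. r *\<^sub>R 1" "-1"]
      by auto
  qed
  then show "range (\<lambda>r. r *\<^sub>R 1) = commutant (unit_set (2 ^ k) e)"
    unfolding commutant by (auto intro: span_intros)
qed (use left_inverse in blast)

text \<open>Up to the sign of \<open>X \<one>\<close>, the span is the real group algebra of a group
  of order 2, with \<open>X z\<close> as the central involution.\<close>

lemma stage_split:
  assumes "U = {\<one>, z}" "z \<noteq> \<one>" "\<mu> z = 1"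
  shows "type_algebra TYPE('b) \<cong>\<^sub>a
    prod_algebra (mat_algebra TYPE(real) (2 ^ k)) (mat_algebra TYPE(real) (2 ^ k))"
proof (rule isomorphic_prod_mat_algebra_if_hom[OF units algebra_hom_real])
  have "z \<in> U" and z: "z \<in> carrier T" using U_carrier assms by auto
  show "X z * X z = 1"
    using X_square[OF z] assms by simp
  show "X z \<noteq> 1" "X z \<noteq> -1"
    using X_not_proportional[OF z one_closed assms(2), of 1]
      X_not_proportional[OF z one_closed assms(2), of "-1"] X_one by auto
  show "X z * r *\<^sub>R 1 = r *\<^sub>R 1 * X z" for r by simp
  let ?V = "range (\<lambda>(p, q). p *\<^sub>R 1 + q *\<^sub>R 1 * X z)"
  have "X ` U \<subseteq> ?V"
    using X_one assms image_eqI[of "1::'b" "\<lambda>(p, q). p *\<^sub>R 1 + q *\<^sub>R 1 * X z" "(1, 0)"]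
      image_eqI[of "-1::'b" "\<lambda>(p, q). p *\<^sub>R 1 + q *\<^sub>R 1 * X z" "(-1, 0)"]
      image_eqI[of "X z" "\<lambda>(p, q). p *\<^sub>R 1 + q *\<^sub>R 1 * X z" "(0, 1)"] by auto
  then have "span (X ` U) \<subseteq> ?V"
    by (intro span_minimal subspace_pair_range algebra_hom_real)
  then show "?V = commutant (unit_set (2 ^ k) e)"
    unfolding commutant using \<open>z \<in> U\<close> by (auto intro!: span_intros)
qed (use left_inverse in blast)

text \<open>\<open>X z\<close> is a square root of -1 and plays the part of the imaginary
  unit.\<close>

lemma stage_complex:
  assumes "U = {\<one>, z}" "\<mu> z = -1"
  shows "type_algebra TYPE('b) \<cong>\<^sub>a mat_algebra TYPE(complex) (2 ^ k)"
proof -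
  let ?\<psi> = "\<lambda>w. Re w *\<^sub>R 1 + Im w *\<^sub>R X z"
  have "z \<in> U" "z \<in> carrier T" using U_carrier assms by auto
  then have hom: "algebra_hom_on UNIV ?\<psi>"
    using assms by (intro algebra_hom_complex) (simp add: X_square)
  have "X ` U \<subseteq> range ?\<psi>"
    using X_one assms image_eqI[of "1::'b" ?\<psi> 1] image_eqI[of "-1::'b" ?\<psi> "-1"]
      image_eqI[of "X z" ?\<psi> \<i>] by auto
  then have "span (X ` U) \<subseteq> range ?\<psi>"
    by (intro span_minimal subspace_algebra_hom_range hom)
  then have "range ?\<psi> = commutant (unit_set (2 ^ k) e)"
    unfolding commutant using \<open>z \<in> U\<close> by (auto intro!: span_intros)
  then show ?thesis
    using left_inverse by (intro isomorphic_mat_algebra_if_hom[OF units hom]) blast+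
qed

context
  fixes a b
  assumes a: "a \<in> U" "\<mu> a = -1" and b: "b \<in> U" "\<mu> b = -1" and ab: "\<beta> a b = -1"
begin

private abbreviation "\<psi> \<equiv> quat_hom (X a) (X b)"

private lemma ab_carrier: "a \<in> carrier T" "b \<in> carrier T"
  using U_carrier a b by auto

text \<open>\<open>X a\<close> and \<open>X b\<close> square to -1 and anticommute, so they satisfy
  the relations of the quaternion units \<open>i\<close> and \<open>j\<close>.\<close>

private lemma hom: "algebra_hom_on UNIV \<psi>"
  using X_square ab_carrier a b ab X_commute[of a b] by (intro algebra_hom_quat) auto

private lemma \<psi>_basis: "\<psi> 1 = 1" "\<psi> (- 1) = -1" "\<psi> 0 = 0" "\<psi> (Quat 0 1 0 0) = X a" "\<psi> (Quat 0 0 1 0) = X b"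
  by (simp_all add: quat_hom_def one_quat_def uminus_quat_def zero_quat_def)

private lemma \<psi>_span: "\<psi> q \<in> span (X ` U)"
  unfolding quat_hom_def using a b by (intro span_intros)

lemma stage_quat:
  assumes "perp U {a, b} = {\<one>}"
  shows "type_algebra TYPE('b) \<cong>\<^sub>a mat_algebra TYPE(quat) (2 ^ k)"
proof (rule isomorphic_mat_algebra_if_hom[OF units hom])
  have closed: "\<psi> p * v \<in> range \<psi>" if "v \<in> range \<psi>" for p v
    using that hom by (auto simp: algebra_hom_on_def) (metis UNIV_I rangeI)
  have "span (X ` U) \<subseteq> range \<psi>"
  proof (rule span_hyperbolic_split[OF U a(1) b(1) ab])
    show "X t \<in> range \<psi>" if "t \<in> perp U {a, b}" for t
      using X_one that assms \<psi>_basis(1,2) by (metis rangeI singletonD)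
    show "X a * v \<in> range \<psi>" "X b * v \<in> range \<psi>" if "v \<in> range \<psi>" for v
      using closed[OF that] \<psi>_basis by metis+
  qed (rule subspace_algebra_hom_range[OF hom])
  then show "range \<psi> = commutant (unit_set (2 ^ k) e)"
    unfolding commutant using \<psi>_span by blast
qed (rule quat_left_inverse)

text \<open>\<open>X z\<close> is an involution commuting with the copy of the quaternions generated
  by \<open>X a\<close> and \<open>X b\<close>, and the span is this copy plus its multiple by
  \<open>X z\<close>.\<close>

lemma stage_quat_split:
  assumes perp: "perp U {a, b} = {\<one>, z}" and z: "z \<noteq> \<one>" "\<mu> z = 1"
  shows "type_algebra TYPE('b) \<cong>\<^sub>a
    prod_algebra (mat_algebra TYPE(quat) (2 ^ k)) (mat_algebra TYPE(quat) (2 ^ k))"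
proof (rule isomorphic_prod_mat_algebra_if_hom[OF units hom])
  have zU: "z \<in> U" "\<beta> a z = 1" "\<beta> b z = 1"
    using perp by (auto simp: perp_def)
  then have zT: "z \<in> carrier T" using U_carrier by auto
  show "X z * X z = 1"
    using X_square[OF zT] z by simp
  show "X z \<noteq> 1" "X z \<noteq> -1"
    using X_not_proportional[OF zT one_closed z(1), of 1]
      X_not_proportional[OF zT one_closed z(1), of "-1"] X_one by auto
  have comm: "X z * X a = X a * X z" "X z * X b = X b * X z"
    using X_commute[of a z] X_commute[of b z] ab_carrier zT zU by simp_all
  then have "X z * (X a * X b) = X a * X b * X z"
    by (metis mult.assoc)
  then show "X z * \<psi> q = \<psi> q * X z" for q
    by (simp add: quat_hom_def algebra_simps comm)
  let ?V = "range (\<lambda>(p, q). \<psi> p + \<psi> q * X z)"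
  have closed: "\<psi> r * v \<in> ?V" if "v \<in> ?V" for r v
  proof -
    obtain p q where "v = \<psi> p + \<psi> q * X z" using \<open>v \<in> ?V\<close> by auto
    then have "\<psi> r * v = \<psi> (r * p) + \<psi> (r * q) * X z"
      using hom by (simp add: algebra_hom_on_def algebra_simps)
    then show ?thesis by auto
  qed
  have "span (X ` U) \<subseteq> ?V"
  proof (rule span_hyperbolic_split[OF U a(1) b(1) ab])
    have *: "1 \<in> ?V" "-1 \<in> ?V" "X z \<in> ?V"
      by (rule image_eqI[of _ _ "(1, 0)"] image_eqI[of _ _ "(-1, 0)"] image_eqI[of _ _ "(0, 1)"],
        simp_all add: \<psi>_basis)+
    show "X t \<in> ?V" if "t \<in> perp U {a, b}" for t
      using that unfolding perp by (metis * X_one insertE singletonD)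
    show "X a * v \<in> ?V" "X b * v \<in> ?V" if "v \<in> ?V" for v
      using closed[OF that, of "Quat 0 1 0 0"] closed[OF that, of "Quat 0 0 1 0"] \<psi>_basis by simp_all
  qed (rule subspace_pair_range[OF hom])
  then show "?V = commutant (unit_set (2 ^ k) e)"
    unfolding commutant using \<psi>_span zU by (auto intro!: span_intros)
qed (rule quat_left_inverse)

end

end


section \<open>The five cases\<close>

text \<open>Each alternative is a complete description, so that the parity of \<open>N\<close> and
  the exclusion of other Arf invariants come out together with the isomorphism. The shifts 0, 2, 1,
  1, 3 are the binary logarithms of the order of the last \<open>U\<close>, which is 1, 4, 2, 2, 8,
  since \<open>2 ^ N = 4 ^ k * card U\<close>.\<close>

lemma classification:
  assumes N: "card (carrier T) = 2 ^ N" and R: "card (radical (carrier T)) \<in> {1, 2}"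
  shows "(\<exists>k. N = 2 * k \<and> card (radical (carrier T)) = 1 \<and> Arf (carrier T) \<mu> = 1 \<and>
        type_algebra TYPE('b) \<cong>\<^sub>a mat_algebra TYPE(real) (2 ^ k)) \<or>
    (\<exists>k. N = 2 * k + 2 \<and> card (radical (carrier T)) = 1 \<and> Arf (carrier T) \<mu> = -1 \<and>
        type_algebra TYPE('b) \<cong>\<^sub>a mat_algebra TYPE(quat) (2 ^ k)) \<or>
    (\<exists>k. N = 2 * k + 1 \<and> card (radical (carrier T)) = 2 \<and> Arf (carrier T) \<mu> = 1 \<and>
        type_algebra TYPE('b) \<cong>\<^sub>a
          prod_algebra (mat_algebra TYPE(real) (2 ^ k)) (mat_algebra TYPE(real) (2 ^ k))) \<or>
    (\<exists>k. N = 2 * k + 1 \<and> card (radical (carrier T)) = 2 \<and> Arf (carrier T) \<mu> = 0 \<and>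
        type_algebra TYPE('b) \<cong>\<^sub>a mat_algebra TYPE(complex) (2 ^ k)) \<or>
    (\<exists>k. N = 2 * k + 3 \<and> card (radical (carrier T)) = 2 \<and> Arf (carrier T) \<mu> = -1 \<and>
        type_algebra TYPE('b) \<cong>\<^sub>a
          prod_algebra (mat_algebra TYPE(quat) (2 ^ k)) (mat_algebra TYPE(quat) (2 ^ k)))"
proof -
  let ?R = "radical (carrier T)"
  obtain k e U where stage: "hyperbolic_stage k e U"
    and anisotropic: "\<And>a b. a \<in> U \<Longrightarrow> b \<in> U \<Longrightarrow> \<beta> a b = -1 \<Longrightarrow> \<mu> a = -1"
    using hyperbolic_stage_final[OF hyperbolic_stage_0] by blast
  have U: "subgroup U T" "U \<subseteq> carrier T" and rad: "radical U = ?R"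
    using stage subgroup.subset by (auto simp: hyperbolic_stage_def)
  have card_eq: "2 ^ N = (2 ^ (2 * k) * card U)" and sum_eq: "sum \<mu> (carrier T) = 2 ^ k * sum \<mu> U"
    using stage N by (simp_all add: hyperbolic_stage_def power_mult)
  have N_eq: "N = 2 * k + l" if "card U = 2 ^ l" for l
    using card_eq unfolding that by (simp flip: power_add)
  have one: "\<one> \<in> ?R"
  proof -
    have "\<one> \<in> U" using U subgroup.one_closed by blast
    moreover have "\<beta> u \<one> = 1" if "u \<in> carrier T" for u
      using beta_mult_right[of \<one> \<one> u] beta_sign[of u \<one>] that by auto
    ultimately show ?thesis
      by (auto simp: radical_def perp_def)
  qed
  have R_cases: "?R = {\<one>} \<or> (\<exists>z. z \<noteq> \<one> \<and> ?R = {\<one>, z})"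
    using R one by (auto simp: card_1_singleton_iff card_2_iff)
  show ?thesis
  proof (cases "\<exists>a\<in>U. \<exists>b\<in>U. \<beta> a b = -1")
    case False
    then have "\<beta> a b = 1" if "a \<in> U" "b \<in> U" for a b
      using beta_sign[of a b] U(2) that by blast
    then have UR: "U = ?R"
      unfolding rad[symmetric] by (auto simp: radical_def perp_def)
    show ?thesis
    proof (cases "?R = {\<one>}")
      case True
      then show ?thesis
        using stage_trivial[OF stage] N_eq[of 0] sum_eq UR mu_one by (auto simp: Arf_mu)
    next
      case False
      then obtain z where z: "z \<noteq> \<one>" "?R = {\<one>, z}" using R_cases by blast
      then have "z \<in> carrier T" using U UR by auto
      \<comment> \<open>\<open>1 + \<mu> z\<close> is 2 or 0, so the Arf invariant is 1 or 0 here,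
        never -1.\<close>
      have eqs: "card ?R = 2" "N = 2 * k + 1" "sum \<mu> (carrier T) = 2 ^ k * (1 + \<mu> z)"
        using N_eq[of 1] sum_eq UR z mu_one by auto
      show ?thesis
        using mu_sign[OF \<open>z \<in> carrier T\<close>] stage_split[OF stage, of z] stage_complex[OF stage, of z]
          z UR eqs by (auto simp: Arf_mu)
    qed
  next
    case True
    then obtain a b where ab: "a \<in> U" "b \<in> U" "\<beta> a b = -1" by blast
    have carrier: "a \<in> carrier T" "b \<in> carrier T" using ab U by auto
    have mu_ab: "\<mu> a = -1" "\<mu> b = -1"
      using anisotropic[OF ab] anisotropic[OF ab(2,1)] ab(3) beta_sym[OF carrier] by auto
    \<comment> \<open>Multiplying \<open>t\<close> by \<open>a\<close> flips the sign of \<open>\<mu> t\<close>, but \<open>a \<otimes> t\<close> still anticommutes with \<open>b\<close>.\<close>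
    have mu_perp: "\<mu> t = 1" if "t \<in> perp U {a, b}" for t
    proof -
      have t: "t \<in> U" "t \<in> carrier T" "\<beta> a t = 1" "\<beta> b t = 1"
        using that U by (auto simp: perp_def)
      have "\<beta> (a \<otimes> t) b = -1"
        using t carrier ab by (simp add: beta_mult_left beta_sym[of t b])
      then have "\<mu> (a \<otimes> t) = -1"
        using anisotropic ab t subgroup.m_closed[OF U(1)] by blast
      then show ?thesis
        using t carrier mu_ab by (simp add: mu_mult)
    qed
    \<comment> \<open>An element \<open>t\<close> of the complement that anticommuted with some
      \<open>u \<in> U\<close> would have \<open>\<mu> t = -1\<close> by anisotropy, against
      \<open>mu_perp\<close>.\<close>
    have perp: "perp U {a, b} = ?R"
      unfolding rad[symmetric]
    proof (intro equalityI subsetI)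
      fix t assume t: "t \<in> perp U {a, b}"
      then have tU: "t \<in> U" by (simp add: perp_def)
      have "\<beta> u t = 1" if "u \<in> U" for u
      proof -
        have "u \<in> carrier T" "t \<in> carrier T" using U tU that by auto
        moreover have "\<beta> t u \<noteq> -1"
          using anisotropic[OF tU that] mu_perp[OF t] by auto
        ultimately show ?thesis
          using beta_sign[of u t] beta_sym[of u t] by auto
      qed
      then show "t \<in> radical U"
        using tU by (simp add: radical_def perp_def)
    qed (use ab in \<open>auto simp: radical_def perp_def\<close>)
    have cardU: "card U = 4 * card ?R"
      using card_hyperbolic_split[OF U(1) ab] perp by simp
    \<comment> \<open>The factor of \<open>sum_mu_hyperbolic_split\<close> is
      \<open>1 - 1 - 1 - 1\<close>, and \<open>\<mu>\<close> is 1 on the complement, which is the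
      radical.\<close>
    have "sum \<mu> U = -2 * card ?R"
      using sum_mu_hyperbolic_split[OF U(1) ab] mu_perp mu_ab perp by simp
    then have Arf: "Arf (carrier T) \<mu> = -1"
      using R sum_eq by (auto simp: Arf_mu)
    note quat = stage_quat[OF stage ab(1) mu_ab(1) ab(2) mu_ab(2) ab(3)]
      stage_quat_split[OF stage ab(1) mu_ab(1) ab(2) mu_ab(2) ab(3)]
    show ?thesis
    proof (cases "?R = {\<one>}")
      case True
      then show ?thesis
        using quat(1) perp Arf cardU N_eq[of 2] by auto
    next
      case False
      then obtain z where z: "z \<noteq> \<one>" "?R = {\<one>, z}" using R_cases by blast
      then show ?thesis
        using quat(2)[of z] perp Arf cardU N_eq[of 3] mu_perp[of z] by auto
    qed
  qed
qed

end

section \<open>From division gradings to signed bases\<close>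

lemma subspace_dim_1:
  fixes V :: "'a::real_vector set"
  assumes "subspace V" "dim V = 1" "x \<in> V" "x \<noteq> 0" "y \<in> V"
  obtains c where "y = c *\<^sub>R x"
proof -
  obtain B where B: "V \<subseteq> span B" "card B = dim V"
    by (rule basis_exists[of V])
  then obtain b where "B = {b}"
    using assms(2) by (metis card_1_singletonE)
  then have "x \<in> span {b}" "y \<in> span {b}"
    using B assms(3,5) by auto
  then obtain c d where cd: "x = c *\<^sub>R b" "y = d *\<^sub>R b"
    unfolding span_singleton by blast
  then have "y = (d / c) *\<^sub>R x"
    using assms(4) by simp
  then show ?thesis
    by (rule that)
qed

section \<open>Elementary abelian 2-groups\<close>

lemma (in group) comm_group_if_self_inverse:
  assumes "\<And>x. x \<in> carrier G \<Longrightarrow> x \<otimes> x = \<one>"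
  shows "comm_group G"
proof (rule group_comm_groupI)
  fix x y assume xy: "x \<in> carrier G" "y \<in> carrier G"
  have inv: "inv z = z" if "z \<in> carrier G" for z
    using assms[OF that] that by (simp add: inv_equality)
  have "x \<otimes> y = inv (x \<otimes> y)"
    by (rule inv[symmetric]) (simp add: xy)
  also have "\<dots> = inv y \<otimes> inv x"
    using xy by (rule inv_mult_group)
  also have "\<dots> = y \<otimes> x"
    using inv xy by simp
  finally show "x \<otimes> y = y \<otimes> x" .
qed

lemma elementary_2_group_facts:
  shows group_elementary_2_group: "group (elementary_2_group N)"
    and card_elementary_2_group: "card (carrier (elementary_2_group N)) = 2 ^ N"
    and elementary_2_group_self_inverse: "x \<in> carrier (elementary_2_group N) \<Longrightarrow>
      x \<otimes>\<^bsub>elementary_2_group N\<^esub> x = \<one>\<^bsub>elementary_2_group N\<^esub>"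
proof -
  show "group (elementary_2_group N)"
    by (simp add: elementary_2_group_def)
  show "card (carrier (elementary_2_group N)) = 2 ^ N"
    by (simp add: elementary_2_group_def card_PiE carrier_integer_mod_group)
  show "x \<otimes>\<^bsub>elementary_2_group N\<^esub> x = \<one>\<^bsub>elementary_2_group N\<^esub>"
    by (simp add: elementary_2_group_def integer_mod_group_def)
qed

lemma iso_elementary_2_group:
  assumes "group H" "H \<cong> elementary_2_group N"
  shows "finite (carrier H)" "card (carrier H) = 2 ^ N"
    and "x \<in> carrier H \<Longrightarrow> x \<otimes>\<^bsub>H\<^esub> x = \<one>\<^bsub>H\<^esub>"
proof -
  obtain f where f: "f \<in> iso H (elementary_2_group N)"
    using assms(2) by (auto simp: is_iso_def)
  then have bij: "bij_betw f (carrier H) (carrier (elementary_2_group N))"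
    and hom: "f \<in> hom H (elementary_2_group N)"
    by (auto simp: iso_def)
  show card: "card (carrier H) = 2 ^ N"
    using bij_betw_same_card[OF bij] by (simp add: card_elementary_2_group)
  then show "finite (carrier H)"
    by (intro card_ge_0_finite) simp
  show "x \<otimes>\<^bsub>H\<^esub> x = \<one>\<^bsub>H\<^esub>" if x: "x \<in> carrier H"
  proof (rule inj_onD[OF bij_betw_imp_inj_on[OF bij]])
    have "f (x \<otimes>\<^bsub>H\<^esub> x) = f x \<otimes>\<^bsub>elementary_2_group N\<^esub> f x"
      using hom x by (simp add: hom_mult)
    also have "\<dots> = \<one>\<^bsub>elementary_2_group N\<^esub>"
      using bij x by (intro elementary_2_group_self_inverse) (auto simp: bij_betw_def)
    also have "\<dots> = f \<one>\<^bsub>H\<^esub>"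
      using hom_one[OF hom assms(1) group_elementary_2_group] by simp
    finally show "f (x \<otimes>\<^bsub>H\<^esub> x) = f \<one>\<^bsub>H\<^esub>" .
  qed (use assms(1) x in \<open>auto simp: group.is_monoid monoid.m_closed\<close>)
qed

section \<open>Division gradings with components of dimension one\<close>

context
  fixes G :: "('g, 'm) monoid_scheme" and D :: "'g \<Rightarrow> 'a::real_algebra_1 set"
    and T :: "'g set" and N :: nat
  assumes grading: "division_grading G D" and T: "T = grading_support G D"
    and dim_D: "\<forall>t\<in>T. dim (D t) = 1"
    and subgroup: "subgroup T G" and iso: "G\<lparr>carrier := T\<rparr> \<cong> elementary_2_group N"
begin

private lemma group_G: "group G"
  using grading by (simp add: division_grading_def grading_def)

private lemma group_T: "group (G\<lparr>carrier := T\<rparr>)"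
  using subgroup group_G by (rule subgroup.subgroup_is_group)

private lemmas T_iso = iso_elementary_2_group[OF group_T iso, simplified]

private lemma subspace_D: "t \<in> T \<Longrightarrow> subspace (D t)"
  using grading T
  by (simp add: division_grading_def grading_def direct_sum_decomposition_def grading_support_def)

private lemma D_mult: "s \<in> T \<Longrightarrow> t \<in> T \<Longrightarrow> x \<in> D s \<Longrightarrow> y \<in> D t \<Longrightarrow> x * y \<in> D (s \<otimes>\<^bsub>G\<^esub> t)"
  using grading T by (simp add: division_grading_def grading_def grading_support_def)

text \<open>A nonzero \<open>x\<close> in the identity component has its square on its own line,
  \<open>x * x = c *\<^sub>R x\<close>; cancelling the invertible \<open>x\<close> shows that
  \<open>x\<close> is a nonzero multiple of 1.\<close>

private lemma one_D: "1 \<in> D \<one>\<^bsub>G\<^esub>"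
proof -
  have one: "\<one>\<^bsub>G\<^esub> \<in> T" "\<one>\<^bsub>G\<^esub> \<in> carrier G"
    using subgroup group_G by (auto simp: subgroup.one_closed group.is_monoid)
  obtain x where x: "x \<in> D \<one>\<^bsub>G\<^esub>" "x \<noteq> 0"
    using one subspace_0[OF subspace_D[OF one(1)]] unfolding T grading_support_def by auto
  then obtain y where y: "x * y = 1"
    using grading one by (auto simp: division_grading_def)
  have "x * x \<in> D \<one>\<^bsub>G\<^esub>"
    using D_mult[OF one(1) one(1) x(1) x(1)] group_G by (simp add: group.is_monoid monoid.r_one)
  then obtain c where "x * x = c *\<^sub>R x"
    by (rule subspace_dim_1[OF subspace_D[OF one(1)] bspec[OF dim_D one(1)] x])
  then have "x * (x * y) = c *\<^sub>R (x * y)"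
    by (simp flip: mult.assoc)
  then have "x = c *\<^sub>R 1" "c \<noteq> 0"
    using x by (auto simp: y)
  then have "1 = inverse c *\<^sub>R x" by simp
  then show ?thesis
    using subspace_scale[OF subspace_D[OF one(1)] x(1)] by metis
qed

private lemma square_D:
  assumes "t \<in> T" "x \<in> D t"
  obtains c where "x * x = c *\<^sub>R 1"
proof -
  have one: "\<one>\<^bsub>G\<^esub> \<in> T"
    using subgroup by (rule subgroup.one_closed)
  have "x * x \<in> D \<one>\<^bsub>G\<^esub>"
    using D_mult[OF assms(1) assms(1) assms(2) assms(2)] T_iso(3)[OF assms(1)] by simp
  then show ?thesis
    using that by (rule subspace_dim_1[OF subspace_D[OF one] bspec[OF dim_D one] one_D one_neq_zero])
qed

lemma exists_unit_square:
  assumes t: "t \<in> T"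
  shows "\<exists>x\<in>D t. x\<^sup>2 \<in> {1, -1}"
proof -
  have tG: "t \<in> carrier G" "D t \<noteq> {0}"
    using t by (auto simp: T grading_support_def)
  obtain x where x: "x \<in> D t" "x \<noteq> 0"
    using tG subspace_0[OF subspace_D[OF t]] by auto
  obtain y where y: "y * x = 1"
    using grading tG x by (auto simp: division_grading_def)
  obtain c where c: "x * x = c *\<^sub>R 1"
    using square_D[OF t x(1)] .
  have "y * (x * x) = x"
    using y by (simp flip: mult.assoc)
  then have "c \<noteq> 0"
    using c x by auto
  \<comment> \<open>Rescaling by \<open>r\<close> multiplies the square by
    \<open>1 / \<bar>c\<bar>\<close>; a real factor can normalize only the absolute value of
    \<open>c\<close>, and its sign is what remains.\<close>
  define r where "r = 1 / sqrt \<bar>c\<bar>"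
  have "r * r * c = sgn c"
    using \<open>c \<noteq> 0\<close> by (simp add: r_def sgn_if)
  then have "(r *\<^sub>R x)\<^sup>2 = sgn c *\<^sub>R 1"
    by (simp add: power2_eq_square c)
  then have "(r *\<^sub>R x)\<^sup>2 \<in> {1, -1}"
    using \<open>c \<noteq> 0\<close> by (auto simp: sgn_if)
  then show ?thesis
    using subspace_scale[OF subspace_D[OF t] x(1)] by blast
qed

text \<open>Uniqueness of homogeneous decompositions gives independence of the \<open>X t\<close>,
  their existence gives spanning, and the scalar in a product comes from the components being
  lines.\<close>

lemma elementary_2_gradingI:
  assumes X: "\<And>t. t \<in> T \<Longrightarrow> X t \<in> D t" and \<mu>: "\<And>t. t \<in> T \<Longrightarrow> \<mu> t \<in> {1, -1}"
    and X_\<mu>: "\<And>t. t \<in> T \<Longrightarrow> (X t)\<^sup>2 = \<mu> t *\<^sub>R 1"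
  shows "elementary_2_grading (G\<lparr>carrier := T\<rparr>) X \<mu>"
proof -
  interpret comm_group "G\<lparr>carrier := T\<rparr>"
    using group.comm_group_if_self_inverse[OF group_T] T_iso(3) by simp
  have TG: "T \<subseteq> carrier G"
    by (auto simp: T grading_support_def)
  have nonzero: "X t \<noteq> 0" if "t \<in> T" for t
    using X_\<mu>[OF that] \<mu>[OF that] by auto
  have line: "\<exists>c. y = c *\<^sub>R X t" if "t \<in> T" "y \<in> D t" for t y
    by (rule subspace_dim_1[OF subspace_D[OF that(1)] bspec[OF dim_D that(1)] X[OF that(1)]
          nonzero[OF that(1)] that(2)]) blast
  have D_zero: "D g = {0}" if "g \<in> carrier G" "g \<notin> T" for g
    using that by (simp add: T grading_support_def)
  define components where "components x f \<longleftrightarrow> (\<forall>g\<in>carrier G. f g \<in> D g) \<and>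
      (\<forall>g. g \<notin> carrier G \<longrightarrow> f g = 0) \<and> finite {g. f g \<noteq> 0} \<and> x = (\<Sum>g | f g \<noteq> 0. f g)"
    for x and f :: "'g \<Rightarrow> 'a"
  have decomposition: "\<exists>!f. components x f" for x
    using grading unfolding components_def
    by (simp add: division_grading_def grading_def direct_sum_decomposition_def)
  show ?thesis
  proof unfold_locales
    show "finite (carrier (G\<lparr>carrier := T\<rparr>))"
      using T_iso(1) by simp
    fix t assume "t \<in> carrier (G\<lparr>carrier := T\<rparr>)"
    then have t: "t \<in> T" by simp
    show "t \<otimes>\<^bsub>G\<lparr>carrier := T\<rparr>\<^esub> t = \<one>\<^bsub>G\<lparr>carrier := T\<rparr>\<^esub>"
      using T_iso(3)[OF t] by simp
    show "\<mu> t \<in> {1, -1}"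
      by (rule \<mu>[OF t])
    show "X t * X t = \<mu> t *\<^sub>R 1"
      using X_\<mu>[OF t] by (simp add: power2_eq_square)
    show "\<exists>c. X s * X t = c *\<^sub>R X (s \<otimes>\<^bsub>G\<lparr>carrier := T\<rparr>\<^esub> t)"
      if "s \<in> carrier (G\<lparr>carrier := T\<rparr>)" for s
      using that t line D_mult[of s t] X subgroup.m_closed[OF subgroup] by simp
  next
    fix c t assume sum: "(\<Sum>t\<in>carrier (G\<lparr>carrier := T\<rparr>). c t *\<^sub>R X t) = 0"
      and "t \<in> carrier (G\<lparr>carrier := T\<rparr>)"
    then have t: "t \<in> T" by simp
    \<comment> \<open>The terms of the relation, extended by zero to all of \<open>G\<close>, form a
      decomposition of 0 to be compared with the zero family.\<close>
    define f where "f g = (if g \<in> T then c g *\<^sub>R X g else 0)" for g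
    have "f g \<in> D g" if "g \<in> carrier G" for g
      using subspace_scale[OF subspace_D X] D_zero[OF that] by (simp add: f_def)
    moreover have fin: "{g. f g \<noteq> 0} \<subseteq> T"
      by (auto simp: f_def)
    moreover have "(\<Sum>g | f g \<noteq> 0. f g) = (\<Sum>g\<in>T. f g)"
      using fin T_iso(1) by (intro sum.mono_neutral_left) auto
    then have "(\<Sum>g | f g \<noteq> 0. f g) = 0"
      using sum by (simp add: f_def)
    moreover have "finite {g. f g \<noteq> 0}"
      using fin T_iso(1) by (rule finite_subset)
    moreover have "f g = 0" if "g \<notin> carrier G" for g
      using that TG by (auto simp: f_def)
    ultimately have "components 0 f"
      by (simp add: components_def)
    moreover have "0 \<in> D g" if "g \<in> carrier G" for g
      using subspace_0[OF subspace_D] D_zero[OF that] by (cases "g \<in> T") simp_all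
    then have "components 0 (\<lambda>_. 0)"
      by (simp add: components_def)
    ultimately have "f = (\<lambda>_. 0)"
      using decomposition by blast
    then have "f t = 0" by simp
    then show "c t = 0"
      using t nonzero by (simp add: f_def)
  next
    fix x
    obtain f where f: "\<forall>g\<in>carrier G. f g \<in> D g" "\<forall>g. g \<notin> carrier G \<longrightarrow> f g = 0"
        "x = (\<Sum>g | f g \<noteq> 0. f g)"
      using decomposition[of x] unfolding components_def by blast
    have "{g. f g \<noteq> 0} \<subseteq> T"
      using f D_zero by blast
    then have "x = (\<Sum>g\<in>T. f g)"
      unfolding f(3) using T_iso(1) by (intro sum.mono_neutral_left) auto
    moreover have "\<forall>g\<in>T. \<exists>c. f g = c *\<^sub>R X g"
      using f(1) line TG by blast
    then obtain c where "\<forall>g\<in>T. f g = c g *\<^sub>R X g"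
      by (rule bchoice[THEN exE])
    ultimately have "x = (\<Sum>t\<in>carrier (G\<lparr>carrier := T\<rparr>). c t *\<^sub>R X t)"
      by simp
    then show "\<exists>c. x = (\<Sum>t\<in>carrier (G\<lparr>carrier := T\<rparr>). c t *\<^sub>R X t)"
      by (intro exI[of _ c])
  qed
qed

lemma card_T: "card T = 2 ^ N"
  using T_iso(2) .

end

theorem theorem5p5:
  fixes G :: "('g, 'm) monoid_scheme"
    and D :: "'g \<Rightarrow> 'a::real_algebra_1 set"
    and T :: "'g set"
    and N :: nat
  assumes "finite_dimensional TYPE('a)"
    and "dim (algebra_center :: 'a set) \<in> {1, 2}"
    and "division_grading G D"
    and "T = grading_support G D"
    and "\<forall>t\<in>T. dim (D t) = 1"
    and "subgroup T G"
    and "G\<lparr>carrier := T\<rparr> \<cong> elementary_2_group N"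
  shows "(dim (algebra_center :: 'a set) = 1 \<longleftrightarrow> even N) \<and>
    (dim (algebra_center :: 'a set) = 2 \<longleftrightarrow> odd N) \<and>
    (\<forall>t\<in>T. \<exists>x\<in>D t. x\<^sup>2 \<in> {1, -1}) \<and>
    (\<forall>(X :: 'g \<Rightarrow> 'a) (\<mu> :: 'g \<Rightarrow> real).
      (\<forall>t\<in>T. X t \<in> D t \<and> (X t)\<^sup>2 \<in> {1, -1} \<and> \<mu> t \<in> {1, -1} \<and> (X t)\<^sup>2 = \<mu> t *\<^sub>R 1) \<longrightarrow>
      quadratic_form (G\<lparr>carrier := T\<rparr>) \<mu> \<and>
      (\<forall>m. dim (algebra_center :: 'a set) = 1 \<and> N = 2 * m \<longrightarrow>
        Arf T \<mu> \<in> {1, -1} \<and>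
        (Arf T \<mu> = 1 \<longrightarrow>
          type_algebra TYPE('a) \<cong>\<^sub>a mat_algebra TYPE(real) (2 ^ m)) \<and>
        (Arf T \<mu> = -1 \<longrightarrow> m \<ge> 1 \<and>
          type_algebra TYPE('a) \<cong>\<^sub>a mat_algebra TYPE(quat) (2 ^ (m - 1)))) \<and>
      (\<forall>m. dim (algebra_center :: 'a set) = 2 \<and> N = 2 * m + 1 \<longrightarrow>
        (Arf T \<mu> = 1 \<longrightarrow>
          type_algebra TYPE('a) \<cong>\<^sub>a
            prod_algebra (mat_algebra TYPE(real) (2 ^ m)) (mat_algebra TYPE(real) (2 ^ m))) \<and>
        (Arf T \<mu> = 0 \<longrightarrow>
          type_algebra TYPE('a) \<cong>\<^sub>a mat_algebra TYPE(complex) (2 ^ m)) \<and>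
        (Arf T \<mu> = -1 \<longrightarrow> m \<ge> 1 \<and>
          type_algebra TYPE('a) \<cong>\<^sub>a
            prod_algebra (mat_algebra TYPE(quat) (2 ^ (m - 1)))
              (mat_algebra TYPE(quat) (2 ^ (m - 1))))))"
proof -
  note dim = assms(2) and hyps = assms(3-7)
  have squares: "\<forall>t\<in>T. \<exists>x\<in>D t. x\<^sup>2 \<in> {1, -1}"
    using exists_unit_square[OF hyps] by blast
  \<comment> \<open>Parity is included although it does not mention \<open>X\<close>, because its
    proof passes through a homogeneous basis.\<close>
  have main: "((dim (algebra_center :: 'a set) = 1 \<longleftrightarrow> even N) \<and>
      (dim (algebra_center :: 'a set) = 2 \<longleftrightarrow> odd N)) \<and>
      quadratic_form (G\<lparr>carrier := T\<rparr>) \<mu> \<and>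
      (\<forall>m. dim (algebra_center :: 'a set) = 1 \<and> N = 2 * m \<longrightarrow>
        Arf T \<mu> \<in> {1, -1} \<and>
        (Arf T \<mu> = 1 \<longrightarrow>
          type_algebra TYPE('a) \<cong>\<^sub>a mat_algebra TYPE(real) (2 ^ m)) \<and>
        (Arf T \<mu> = -1 \<longrightarrow> m \<ge> 1 \<and>
          type_algebra TYPE('a) \<cong>\<^sub>a mat_algebra TYPE(quat) (2 ^ (m - 1)))) \<and>
      (\<forall>m. dim (algebra_center :: 'a set) = 2 \<and> N = 2 * m + 1 \<longrightarrow>
        (Arf T \<mu> = 1 \<longrightarrow>
          type_algebra TYPE('a) \<cong>\<^sub>a
            prod_algebra (mat_algebra TYPE(real) (2 ^ m)) (mat_algebra TYPE(real) (2 ^ m))) \<and>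
        (Arf T \<mu> = 0 \<longrightarrow>
          type_algebra TYPE('a) \<cong>\<^sub>a mat_algebra TYPE(complex) (2 ^ m)) \<and>
        (Arf T \<mu> = -1 \<longrightarrow> m \<ge> 1 \<and>
          type_algebra TYPE('a) \<cong>\<^sub>a
            prod_algebra (mat_algebra TYPE(quat) (2 ^ (m - 1)))
              (mat_algebra TYPE(quat) (2 ^ (m - 1)))))"
    if "\<forall>t\<in>T. X t \<in> D t \<and> (X t)\<^sup>2 \<in> {1, -1} \<and> \<mu> t \<in> {1, -1} \<and> (X t)\<^sup>2 = \<mu> t *\<^sub>R 1"
    for X :: "'g \<Rightarrow> 'a" and \<mu> :: "'g \<Rightarrow> real"
  proof -
    interpret elementary_2_grading "G\<lparr>carrier := T\<rparr>" X \<mu>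
      using that by (intro elementary_2_gradingI[OF hyps]) auto
    have card: "card (carrier (G\<lparr>carrier := T\<rparr>)) = 2 ^ N"
      using card_T[OF hyps] by simp
    have rad: "card (radical (carrier (G\<lparr>carrier := T\<rparr>))) \<in> {1, 2}"
      using dim unfolding dim_algebra_center .
    \<comment> \<open>In the two quaternionic cases the number \<open>k\<close> of splittings is
      \<open>m - 1\<close>.\<close>
    have "2 * k + 2 = 2 * m \<longleftrightarrow> m = Suc k" "2 * k + 3 = 2 * m + 1 \<longleftrightarrow> m = Suc k" for k m :: nat
      by auto
    then show ?thesis
      unfolding dim_algebra_center using quadratic_form_mu
      using classification[OF card rad] by (elim disjE exE; simp)
  qed
  \<comment> \<open>One choice of homogeneous elements suffices to extract the parity; the default
    sign -1 below is correct because each square is 1 or -1.\<close>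
  obtain X where "\<forall>t\<in>T. X t \<in> D t \<and> (X t)\<^sup>2 \<in> {1, -1}"
    using bchoice[of T "\<lambda>t x. x \<in> D t \<and> x\<^sup>2 \<in> {1, -1}"] squares by blast
  then have X: "\<forall>t\<in>T. X t \<in> D t \<and> (X t)\<^sup>2 \<in> {1, -1} \<and>
      (if (X t)\<^sup>2 = 1 then 1 else -1) \<in> {1, -1 :: real} \<and>
      (X t)\<^sup>2 = (if (X t)\<^sup>2 = 1 then 1 else -1 :: real) *\<^sub>R 1"
    by auto
  have parity: "(dim (algebra_center :: 'a set) = 1 \<longleftrightarrow> even N) \<and>
      (dim (algebra_center :: 'a set) = 2 \<longleftrightarrow> odd N)"
    by (rule conjunct1[OF main[OF X]])
  show ?thesis
    by (rule conjI[OF conjunct1[OF parity] conjI[OF conjunct2[OF parity] conjI[OF squares]]],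
        intro allI impI, rule conjunct2[OF main], assumption)
qed

end
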